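(* In the setting of the context (problem $F=f+h$, algorithm Ada-BPSG, standing assumptions 1--6), suppose that the step sizes $\eta_k$ of Ada-BPSG satisfy, for all $k$, $$\eta_{\min}\le \eta_k\le \eta_{\max},\qquad \eta_k\ge \eta_{k-1},\qquad \eta_{\max}\le \frac{1}{\bar L+32\sigma_b M/b}.$$ Let $K\ge 1$ and $\bar x_K=\frac1K\sum_{k=1}^K x_k$. Then $$\mathbb{E}[F(\bar x_K)]-F(x^* )\le \frac{2}{K}\left[\left(\frac{n}{4b}+\frac12\right)\bigl(F(x_0)-F(x^* )\bigr)+\frac{1}{\eta_{\min}}D_\psi(x^*,x_0)\right].$$
   Context: **Setting.** $\mathbf{E}$ is a finite-dimensional real normed space with norm $\|\cdot\|$, dual space $\mathbf{E}^*$, duality pairing $\langle\cdot,\cdot\rangle$ and dual norm $\|y\|_*=\max\{\langle y,x\rangle:\|x\|\le 1\}$. Let $n\ge1$, $[n]=\{1,\dots,n\}$, $f_i:\mathbf{E}\to\mathbb{R}$ for $i\in[n]$, $f=\frac1n\sum_{i=1}^n f_i$, $h:\mathbf{E}\to(-\infty,+\infty]$, and $F=f+h$, to be minimized over $\mathbf{E}$. $\mathcal{X}\subset\mathbf{E}$ is a nonempty, convex, open set on which the $f_i$ are differentiable and $f$ is lower semicontinuous and continuously differentiable. Gradients are elements of $\mathbf{E}^*$. For $\psi:\mathbf{E}\to\mathbb{R}$ differentiable, $D_\psi(x,y)=\psi(x)-\psi(y)-\langle\nabla\psi(y),x-y\rangle$. **Algorithm Ada-BPSG.** Parameters: batch size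 $b\in\{1,\dots,n\}$, initial point $x_0$, bounds $0<\eta_{\min}\le\eta_{\max}$, initial step size $\eta_0\in[\eta_{\min},\eta_{\max}]$, update frequency $m\ge1$ (an integer), $\alpha>0$, $\theta>0$. Initialize $\phi_i^0=x_0$ for all $i$, $\mu_0=\frac1n\sum_i\nabla f_i(\phi_i^0)$, $\xi_0=\delta_0=0$. For $k=0,1,2,\dots$: (i) If $k>0$, set $\eta_k=\eta_{k-1}$. If moreover $k \bmod m=0$, let $\widehat\eta_k=\frac1\alpha\frac{\xi_k}{\delta_k+\theta\xi_k}$ if $\xi_k>0$ and $\widehat\eta_k=\eta_{k-1}$ if $\xi_k=0$; set $\eta_k=\max\{\eta_{k-1},\min\{\eta_{\max},\max\{\eta_{\min},\widehat\eta_k\}\}\}$; then reset $\xi_k=\delta_k=0$. (ii) Draw a batch $B_k\subset[n]$ of size $b$ uniformly without replacement. Set $\phi_i^{k+1}=x_k$ for $i\in B_k$ and $\phi_i^{k+1}=\phi_i^k$ for $i\notin B_k$. (iii) $\widetilde\nabla_k=\frac1b\sum_{i\in B_k}(\nabla f_i(\phi_i^{k+1})-\nabla f_i(\phi_i^k))+\mu_k$. (iv) $x_{k+1}=\arg\min_x\{h(x)+\langle\widetilde\nabla_k,x\rangle+\frac1{\eta_k}D_\psi(x,x_k)\}$. (v) With $y_i=\nabla f_i(\phi_i^{k+1})-\nabla f_i(\phi_i^k)$ and $s_i=\phi_i^{k+1}-\phi_i^k$, set $\xi_{k+1}=\xi_k+\sum_{i\in B_k}|\langle y_i,s_i\rangle|$,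 $\delta_{k+1}=\delta_k+\sum_{i\in B_k}\|y_i\|_*^2$, $\mu_{k+1}=\mu_k+\frac1n\sum_{i\in B_k}y_i$. Let $\mathcal{F}_k=\sigma(B_0,\dots,B_{k-1})$. **Standing assumptions.** 1. $\psi$ is continuously differentiable and 1-strongly convex: $D_\psi(x,y)\ge\frac12\|x-y\|^2$ for all $x,y$. $h$ is proper, closed and convex. For every $x\in D$ ($D$ as in 2), $\mathcal{G}\in\mathbf{E}^*$, $\eta\in[\eta_{\min},\eta_{\max}]$, the problem $\min_u\{\langle\mathcal{G},u\rangle+\frac1\eta D_\psi(u,x)+h(u)\}$ has a unique solution. 2. There is a deterministic bounded convex set $D\subset\mathcal{X}$ with $x_k,\phi_i^k\in D$ almost surely for all $k,i$; moreover a minimizer $x^*$ of $F$ over $\mathbf{E}$ belongs to $D$. 3. Conditionally on $\mathcal{F}_k$, $B_k$ is uniform of size $b$ without replacement from $[n]$. There is a deterministic constant $\sigma_b\ge1$ such that, writing $I_1,\dots,I_b$ for the sampled indices, for all deterministic $v_1,\dots,v_n\in\mathbf{E}^*$ with $\bar v=\frac1n\sum_i v_i$, $\mathbb{E}\bigl[\|\frac1b\sum_{j=1}^b(v_{I_j}-\bar v)\|_*^2\bigr]\le\frac{\sigma_b}{bn}\sum_{i=1}^n\|v_i-\bar v\|_*^2$. 4. There are constants $\bar L>0$, $\underline{L}\ge0$ with $-\underline{L}D_\psi(x,y)\le f(x)-f(y)-\langle\nabla f(y),x-y\rangle\le\bar L D_\psi(x,y)$ for all $x,y\in D$. 5. There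 is a deterministic constant $M\ge0$ with $\|\nabla f_i(x)-\nabla f_i(y)\|_*\le M\|x-y\|$ for all $x,y\in D$, $i\in[n]$. 6. Each $f_i$ is convex on $D$ and $\|\nabla f_i(x)-\nabla f_i(y)\|_*^2\le 2M\bigl(f_i(x)-f_i(y)-\langle\nabla f_i(y),x-y\rangle\bigr)$ for all $x,y\in D$. *)

theory Defs
  imports "HOL-Probability.Probability"
begin

text \<open>
  The dual space of \<open>'a\<close> is \<open>'a \<Rightarrow>\<^sub>L real\<close>: the duality pairing is application, and the operator
  norm of that type is the dual norm.  A gradient is an element of this space.  \<open>grad f x\<close> is
  meaningful only where \<open>f\<close> is differentiable.
\<close>

definition grad :: "('a::real_normed_vector \<Rightarrow> real) \<Rightarrow> 'a \<Rightarrow> ('a \<Rightarrow>\<^sub>L real)" where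
  "grad f x = Blinfun (frechet_derivative f (at x))"

lemma grad_eqI:
  assumes "(f has_derivative blinfun_apply G) (at x)"
  shows "grad f x = G"
  by (simp add: grad_def blinfun_apply_inverse flip: frechet_derivative_at[OF assms])

definition continuously_differentiable_on ::
    "'a set \<Rightarrow> ('a::real_normed_vector \<Rightarrow> real) \<Rightarrow> bool" where
  "continuously_differentiable_on S f \<longleftrightarrow>
     (\<forall>x\<in>S. f differentiable (at x)) \<and> continuous_on S (grad f)"

definition lower_semicontinuous_on ::
    "'a set \<Rightarrow> ('a::topological_space \<Rightarrow> real) \<Rightarrow> bool" where
  "lower_semicontinuous_on S f \<longleftrightarrow>
     (\<forall>x\<in>S. \<forall>c < f x. eventually (\<lambda>y. c < f y) (at x within S))"

definition bregman :: "('a::real_normed_vector \<Rightarrow> real) \<Rightarrow> 'a \<Rightarrow> 'a \<Rightarrow> real" where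
  "bregman \<psi> x y = \<psi> x - \<psi> y - blinfun_apply (grad \<psi> y) (x - y)"

definition ereal_epigraph :: "('a \<Rightarrow> ereal) \<Rightarrow> ('a \<times> real) set" where
  "ereal_epigraph h = {(x, r). h x \<le> ereal r}"

definition proper_closed_convex :: "('a::real_normed_vector \<Rightarrow> ereal) \<Rightarrow> bool" where
  "proper_closed_convex h \<longleftrightarrow>
     (\<forall>x. h x \<noteq> -\<infinity>) \<and> (\<exists>x. h x \<noteq> \<infinity>) \<and>
     closed (ereal_epigraph h) \<and> convex (ereal_epigraph h)"

text \<open>
  Expectation of an extended-real random variable, as the expectation of its positive part minus
  that of its negative part (\<open>e2ennreal\<close> sends negative numbers to \<open>0\<close>).  In \<open>ereal\<close>,
  \<open>\<infinity> - \<infinity> = \<infinity>\<close>, so an upper bound by a finite number excludes the case in which both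
  parts have infinite expectation.
\<close>

definition ereal_expectation :: "'w measure \<Rightarrow> ('w \<Rightarrow> ereal) \<Rightarrow> ereal" where
  "ereal_expectation M X =
     enn2ereal (\<integral>\<^sup>+\<omega>. e2ennreal (X \<omega>) \<partial>M) - enn2ereal (\<integral>\<^sup>+\<omega>. e2ennreal (- X \<omega>) \<partial>M)"

lemma ereal_expectation_integrable:
  fixes Y :: "'w \<Rightarrow> real"
  assumes Y: "integrable M Y"
  shows "ereal_expectation M (\<lambda>\<omega>. ereal (Y \<omega>)) = ereal (integral\<^sup>L M Y)"
proof -
  have fin: "(\<integral>\<^sup>+\<omega>. ennreal (Y \<omega>) \<partial>M) \<noteq> \<infinity>" "(\<integral>\<^sup>+\<omega>. ennreal (- Y \<omega>) \<partial>M) \<noteq> \<infinity>"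
    using Y by (auto simp: real_integrable_def)
  have e: "enn2ereal a = ereal (enn2real a)" if "a \<noteq> \<infinity>" for a :: ennreal
    using that by (cases a) (auto simp: enn2ereal_ennreal)
  show ?thesis
    using real_lebesgue_integral_def[OF Y] e[OF fin(1)] e[OF fin(2)]
    by (simp add: ereal_expectation_def flip: ennreal.abs_eq)
qed

definition batches :: "nat \<Rightarrow> nat \<Rightarrow> nat set set" where
  "batches n b = {S. S \<subseteq> {1..n} \<and> card S = b}"

text \<open>The \<open>\<sigma>\<close>-algebra generated by \<open>B 0, \<dots>, B (k - 1)\<close>.\<close>

definition batch_history :: "'w measure \<Rightarrow> (nat \<Rightarrow> 'w \<Rightarrow> nat set) \<Rightarrow> nat \<Rightarrow> 'w measure" where
  "batch_history M B k = sigma (space M) {B j -` A \<inter> space M | j A. j < k}"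

definition prox_objective ::
    "('a::real_normed_vector \<Rightarrow> ereal) \<Rightarrow> ('a \<Rightarrow> real) \<Rightarrow> ('a \<Rightarrow>\<^sub>L real) \<Rightarrow> real \<Rightarrow> 'a \<Rightarrow> 'a \<Rightarrow> ereal" where
  "prox_objective h \<psi> G \<eta> y u =
     h u + ereal (blinfun_apply G u) + ereal (1 / \<eta> * bregman \<psi> u y)"

text \<open>
  The step size used at iteration \<open>k > 0\<close>, from the previous step size and the accumulators
  \<open>\<xi>\<close>, \<open>\<delta>\<close> as they are before a possible reset.
\<close>

definition next_step_size ::
    "real \<Rightarrow> real \<Rightarrow> nat \<Rightarrow> real \<Rightarrow> real \<Rightarrow> nat \<Rightarrow> real \<Rightarrow> real \<Rightarrow> real \<Rightarrow> real" where
  "next_step_size \<eta>min \<eta>max m \<alpha> \<theta> k \<eta>prev \<xi> \<delta> =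
     (if k mod m = 0
      then let \<eta>hat = (if \<xi> > 0 then 1 / \<alpha> * (\<xi> / (\<delta> + \<theta> * \<xi>)) else \<eta>prev)
           in max \<eta>prev (min \<eta>max (max \<eta>min \<eta>hat))
      else \<eta>prev)"

text \<open>
  \<open>ada_bpsg_run\<close> says that the sequences \<open>x, \<phi>, \<eta>, \<xi>, \<delta>, \<mu>\<close> are produced by the algorithm from
  the sequence of batches \<open>B\<close>.  The component functions are \<open>f 1, \<dots>, f n\<close>, and \<open>\<phi> k i\<close> matters
  only for \<open>i\<close> in \<open>{1..n}\<close>.  The values \<open>\<xi> k\<close>, \<open>\<delta> k\<close> are those on entry to iteration \<open>k\<close>; the
  reset that may follow the step size update is part of the recurrence for \<open>\<xi> (k + 1)\<close>,
  \<open>\<delta> (k + 1)\<close>.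
\<close>

definition ada_bpsg_run ::
    "nat \<Rightarrow> (nat \<Rightarrow> 'a::real_normed_vector \<Rightarrow> real) \<Rightarrow> ('a \<Rightarrow> ereal) \<Rightarrow> ('a \<Rightarrow> real) \<Rightarrow>
     nat \<Rightarrow> 'a \<Rightarrow> real \<Rightarrow> real \<Rightarrow> real \<Rightarrow> nat \<Rightarrow> real \<Rightarrow> real \<Rightarrow>
     (nat \<Rightarrow> nat set) \<Rightarrow> (nat \<Rightarrow> 'a) \<Rightarrow> (nat \<Rightarrow> nat \<Rightarrow> 'a) \<Rightarrow> (nat \<Rightarrow> real) \<Rightarrow>
     (nat \<Rightarrow> real) \<Rightarrow> (nat \<Rightarrow> real) \<Rightarrow> (nat \<Rightarrow> 'a \<Rightarrow>\<^sub>L real) \<Rightarrow> bool" where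
  "ada_bpsg_run n f h \<psi> b x0 \<eta>min \<eta>max \<eta>0 m \<alpha> \<theta> B x \<phi> \<eta> \<xi> \<delta> \<mu> \<longleftrightarrow>
     x 0 = x0 \<and> (\<forall>i\<in>{1..n}. \<phi> 0 i = x0) \<and>
     \<mu> 0 = (1 / real n) *\<^sub>R (\<Sum>i=1..n. grad (f i) (\<phi> 0 i)) \<and>
     \<xi> 0 = 0 \<and> \<delta> 0 = 0 \<and> \<eta> 0 = \<eta>0 \<and>
     (\<forall>k. \<eta> (Suc k) =
            next_step_size \<eta>min \<eta>max m \<alpha> \<theta> (Suc k) (\<eta> k) (\<xi> (Suc k)) (\<delta> (Suc k))) \<and>
     (\<forall>k. \<forall>i\<in>{1..n}. \<phi> (Suc k) i = (if i \<in> B k then x k else \<phi> k i)) \<and>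
     (\<forall>k. let y = (\<lambda>i. grad (f i) (\<phi> (Suc k) i) - grad (f i) (\<phi> k i));
              s = (\<lambda>i. \<phi> (Suc k) i - \<phi> k i);
              G = (1 / real b) *\<^sub>R (\<Sum>i\<in>B k. y i) + \<mu> k;
              reset = (k > 0 \<and> k mod m = 0)
          in is_arg_min (prox_objective h \<psi> G (\<eta> k) (x k)) (\<lambda>_. True) (x (Suc k)) \<and>
             \<xi> (Suc k) = (if reset then 0 else \<xi> k) +
               (\<Sum>i\<in>B k. \<bar>blinfun_apply (y i) (s i)\<bar>) \<and>
             \<delta> (Suc k) = (if reset then 0 else \<delta> k) + (\<Sum>i\<in>B k. (norm (y i))\<^sup>2) \<and>
             \<mu> (Suc k) = \<mu> k + (1 / real n) *\<^sub>R (\<Sum>i\<in>B k. y i))"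

end

theory Submission
  imports Defs
begin

text \<open>
  The algorithm is a proximal SAGA method, and the proof exhibits a Lyapunov function.  Let \<open>H\<^sub>k\<close>
  be the mean over \<open>i\<close> of the Bregman distances \<open>D\<^bsub>f\<^sub>i\<^esub>(\<phi>\<^sub>i\<^sup>k, x\<^sup>*)\<close> of the table points, and let \<open>g\<^sub>k\<close> be
  \<open>F(x\<^sub>k) - F(x\<^sup>*)\<close>.  Given the past, the gradient estimator is unbiased, and cocoercivity
  bounds its variance by a multiple of \<open>D\<^sub>f(x\<^sub>k, x\<^sup>*) + H\<^sub>k\<close> (\<open>saga_variance\<close>).  The bound on the
  step sizes leaves enough of the negative term \<open>- D\<^sub>\<psi>(x\<^sub>k\<^sub>+\<^sub>1, x\<^sub>k)\<close> of the proximal step to reduce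
  the contribution of the variance to a quarter of \<open>D\<^sub>f(x\<^sub>k, x\<^sup>*) + H\<^sub>k\<close> (\<open>one_step\<close>).

  Refreshing the table changes \<open>H\<^sub>k\<close> in the mean by \<open>b / n (D\<^sub>f(x\<^sub>k, x\<^sup>*) - H\<^sub>k)\<close>.  With the weight
  \<open>n / (4 b)\<close> on \<open>H\<close> this cancels the quarter of \<open>H\<^sub>k\<close> and leaves half of \<open>D\<^sub>f(x\<^sub>k, x\<^sup>*)\<close>, which is at
  most \<open>1/2 g\<^sub>k\<close> by optimality of \<open>x\<^sup>*\<close> (\<open>lyapunov_step\<close>).  So in the mean, given the past,
  \<open>g\<^sub>k\<^sub>+\<^sub>1 + n / (4 b) H\<^sub>k\<^sub>+\<^sub>1 + D\<^sub>\<psi>(x\<^sup>*, x\<^sub>k\<^sub>+\<^sub>1) / \<eta>\<^sub>k \<le> 1/2 g\<^sub>k + n / (4 b) H\<^sub>k + D\<^sub>\<psi>(x\<^sup>*, x\<^sub>k) / \<eta>\<^sub>k\<close>.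
  Since the step sizes do not decrease, the last terms telescope; summing over \<open>k\<close> bounds half of
  the sum of the \<open>g\<^sub>k\<close>, and convexity of \<open>F\<close> passes to the averaged iterate.

  The probability involved is finite.  The proximal points are unique, so almost surely \<open>x\<^sub>k\<close>,
  \<open>\<phi>\<^sup>k\<close> and \<open>\<eta>\<^sub>k\<close> are functions of the list of the first \<open>k\<close> batches (\<open>regular_eq\<close>).  There are
  finitely many such lists, and each of them has positive probability (\<open>history_charged\<close>), so
  the hypotheses that hold almost surely are available after every list of batches.  A conditional
  expectation given the past is then an average over the next batch (\<open>expectation_history_Suc\<close>).
\<close>

section \<open>First-order conditions\<close>

lemma has_derivative_grad:
  assumes "g differentiable (at u)"
  shows "(g has_derivative blinfun_apply (grad g u)) (at u)"
proof -
  have d: "(g has_derivative frechet_derivative g (at u)) (at u)"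
    using assms by (simp add: frechet_derivative_works)
  then show ?thesis
    by (simp add: grad_def bounded_linear_Blinfun_apply has_derivative_bounded_linear)
qed

text \<open>
  Both optimality conditions below and the tangent inequality for convex functions are comparisons
  of a difference quotient with a constant along a segment; this is their common limit argument.
\<close>

lemma directional_derivative_ge:
  fixes q :: "'a::real_normed_vector \<Rightarrow> real"
  assumes q: "(q has_derivative q') (at u)"
    and grow: "\<And>t. 0 < t \<Longrightarrow> t < 1 \<Longrightarrow> t * c \<le> q (u + t *\<^sub>R d) - q u"
  shows "c \<le> q' d"
proof -
  interpret bounded_linear q'
    by (rule has_derivative_bounded_linear[OF q])
  have "((\<lambda>t::real. u + t *\<^sub>R d) has_derivative (\<lambda>t. t *\<^sub>R d)) (at 0)"
    by (auto intro!: derivative_eq_intros)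
  from has_derivative_compose[OF this, of q q'] q
  have "((\<lambda>t::real. q (u + t *\<^sub>R d)) has_derivative (\<lambda>t. q' (t *\<^sub>R d))) (at 0)"
    by simp
  then have "((\<lambda>t::real. q (u + t *\<^sub>R d)) has_real_derivative q' d) (at 0)"
    by (simp add: has_field_derivative_def scale mult_commute_abs)
  then have "((\<lambda>t::real. (q (u + t *\<^sub>R d) - q u) / t) \<longlongrightarrow> q' d) (at_right 0)"
    unfolding DERIV_def by (auto intro: tendsto_within_subset)
  moreover have "eventually (\<lambda>t::real. c \<le> (q (u + t *\<^sub>R d) - q u) / t) (at_right 0)"
    using eventually_at_right_real[OF zero_less_one]
    by eventually_elim (use grow in \<open>auto simp: field_simps\<close>)
  ultimately show ?thesis
    by (rule tendsto_lowerbound) (rule trivial_limit_at_right_real)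
qed

lemma convex_on_above_tangent:
  fixes g :: "'a::real_normed_vector \<Rightarrow> real"
  assumes g: "convex_on S g" and uv: "u \<in> S" "v \<in> S"
    and d: "(g has_derivative g') (at v)"
  shows "g' (u - v) \<le> g u - g v"
proof -
  have "- (g u - g v) \<le> - g' (u - v)"
  proof (rule directional_derivative_ge[where q = "\<lambda>w. - g w" and q' = "\<lambda>w. - g' w"])
    show "((\<lambda>w. - g w) has_derivative (\<lambda>w. - g' w)) (at v)"
      using d by (rule has_derivative_minus)
    fix t :: real assume t: "0 < t" "t < 1"
    have "g ((1 - t) *\<^sub>R v + t *\<^sub>R u) \<le> (1 - t) * g v + t * g u"
      using convex_onD[OF g, of t v u] t uv by auto
    then show "t * - (g u - g v) \<le> - g (v + t *\<^sub>R (u - v)) - - g v"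
      by (simp add: algebra_simps)
  qed
  then show ?thesis by simp
qed

lemma proper_closed_convex_segment:
  assumes h: "proper_closed_convex h"
    and "h u = ereal r" "h v = ereal s" "0 \<le> t" "t \<le> 1"
  shows "h ((1 - t) *\<^sub>R u + t *\<^sub>R v) \<le> ereal ((1 - t) * r + t * s)"
proof -
  have "convex (ereal_epigraph h)"
    using h by (simp add: proper_closed_convex_def)
  from convexD_alt[OF this, of "(u, r)" "(v, s)" t] show ?thesis
    using assms by (simp add: ereal_epigraph_def)
qed

text \<open>
  Moving from the minimizer \<open>u\<close> a fraction \<open>t\<close> of the way to \<open>v\<close> changes \<open>h\<close> by at most
  \<open>t (h v - h u)\<close>, by convexity, so \<open>q\<close> must increase by at least \<open>t (h u - h v)\<close>; now let
  \<open>t\<close> tend to \<open>0\<close>.  The lemma serves twice: \<open>q = f\<close> gives the optimality condition for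
  \<open>F\<close> at \<open>x\<^sup>*\<close>, and \<open>q\<close> the smooth part of a proximal problem gives the three-point inequality.
\<close>

lemma minimizer_subgradient:
  fixes h :: "'a::real_normed_vector \<Rightarrow> ereal"
  assumes h: "proper_closed_convex h"
    and q: "(q has_derivative q') (at u)"
    and min: "\<And>w. ereal (q u) + h u \<le> ereal (q w) + h w"
  shows "h u \<noteq> \<infinity>" "h v \<ge> h u - ereal (q' (v - u))"
proof -
  have fin: "h w \<noteq> -\<infinity>" for w
    using h by (simp add: proper_closed_convex_def)
  show u: "h u \<noteq> \<infinity>"
  proof
    assume "h u = \<infinity>"
    moreover obtain w where "h w \<noteq> \<infinity>"
      using h by (auto simp: proper_closed_convex_def)
    ultimately show False
      using min[of w] fin[of w] by (cases "h w") auto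
  qed
  then obtain r where r: "h u = ereal r"
    using fin[of u] by (cases "h u") auto
  show "h v \<ge> h u - ereal (q' (v - u))"
  proof (cases "h v")
    case (real s)
    have "r - s \<le> q' (v - u)"
    proof (rule directional_derivative_ge[OF q])
      fix t :: real assume t: "0 < t" "t < 1"
      have "h ((1 - t) *\<^sub>R u + t *\<^sub>R v) \<le> ereal ((1 - t) * r + t * s)"
        using proper_closed_convex_segment[OF h r real] t by simp
      also have "(1 - t) *\<^sub>R u + t *\<^sub>R v = u + t *\<^sub>R (v - u)"
        by (simp add: algebra_simps)
      finally have "ereal (q u + r) \<le> ereal (q (u + t *\<^sub>R (v - u)) + ((1 - t) * r + t * s))"
        using min[of "u + t *\<^sub>R (v - u)"] fin[of "u + t *\<^sub>R (v - u)"] r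
        by (cases "h (u + t *\<^sub>R (v - u))") auto
      then show "t * (r - s) \<le> q (u + t *\<^sub>R (v - u)) - q u"
        by (simp add: algebra_simps)
    qed
    then show ?thesis by (simp add: r real)
  qed (use fin r in auto)
qed

text \<open>
  The optimality condition of the proximal problem at \<open>p\<close> contains the term
  \<open>\<langle>\<nabla>\<psi>(p) - \<nabla>\<psi>(y), u - p\<rangle>\<close>, which equals \<open>D\<^sub>\<psi>(u, y) - D\<^sub>\<psi>(u, p) - D\<^sub>\<psi>(p, y)\<close>.
\<close>

lemma prox_three_point:
  fixes h :: "'a::real_normed_vector \<Rightarrow> ereal"
  assumes h: "proper_closed_convex h"
    and psi: "\<psi> differentiable (at p)"
    and min: "is_arg_min (prox_objective h \<psi> G \<tau> y) (\<lambda>_. True) p"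
  shows "h p \<noteq> \<infinity>"
    and "h u \<ge> h p + ereal (blinfun_apply G (p - u)
           + 1 / \<tau> * (bregman \<psi> u p + bregman \<psi> p y - bregman \<psi> u y))"
proof -
  define \<kappa> where "\<kappa> = 1 / \<tau>"
  define q where "q u = blinfun_apply G u + \<kappa> * bregman \<psi> u y" for u
  have q: "(q has_derivative (\<lambda>d. blinfun_apply G d
              + \<kappa> * (blinfun_apply (grad \<psi> p) d - blinfun_apply (grad \<psi> y) d))) (at p)"
  proof -
    have "((\<lambda>w. blinfun_apply G w + \<kappa> * (\<psi> w - \<psi> y - blinfun_apply (grad \<psi> y) (w - y)))
        has_derivative (\<lambda>d. blinfun_apply G d
              + \<kappa> * (blinfun_apply (grad \<psi> p) d - 0 - blinfun_apply (grad \<psi> y) (d - 0)))) (at p)"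
      by (intro has_derivative_add has_derivative_mult_right has_derivative_diff
          has_derivative_grad[OF psi] has_derivative_const has_derivative_ident
          bounded_linear.has_derivative[OF blinfun.bounded_linear_right])
    then show ?thesis by (simp add: q_def[abs_def] bregman_def)
  qed
  have obj: "ereal (q u) + h u = prox_objective h \<psi> G \<tau> y u" for u
    using h by (cases "h u") (auto simp: q_def \<kappa>_def prox_objective_def proper_closed_convex_def)
  have min': "ereal (q p) + h p \<le> ereal (q w) + h w" for w
    using min by (simp add: obj is_arg_min_linorder)
  note sub = minimizer_subgradient[OF h q min']
  show fin: "h p \<noteq> \<infinity>" by (rule sub)
  moreover have "h p \<noteq> -\<infinity>" using h by (simp add: proper_closed_convex_def)
  ultimately obtain r where r: "h p = ereal r" by (cases "h p") auto
  have "h p + ereal (blinfun_apply G (p - u)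
           + \<kappa> * (bregman \<psi> u p + bregman \<psi> p y - bregman \<psi> u y))
      = h p - ereal (blinfun_apply G (u - p)
              + \<kappa> * (blinfun_apply (grad \<psi> p) (u - p) - blinfun_apply (grad \<psi> y) (u - p)))"
    by (simp add: r bregman_def blinfun.bilinear_simps) (simp add: algebra_simps)
  then show "h u \<ge> h p + ereal (blinfun_apply G (p - u)
           + 1 / \<tau> * (bregman \<psi> u p + bregman \<psi> p y - bregman \<psi> u y))"
    using sub(2)[of u] by (simp add: \<kappa>_def)
qed

section \<open>Averages over batches\<close>

definition batch_mean :: "nat \<Rightarrow> nat \<Rightarrow> (nat set \<Rightarrow> real) \<Rightarrow> real" where
  "batch_mean n b g = (\<Sum>S\<in>batches n b. g S) / real (n choose b)"

lemma finite_batches [simp]: "finite (batches n b)"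
  by (rule finite_subset[of _ "Pow {1..n}"]) (auto simp: batches_def)

lemma card_batches: "card (batches n b) = n choose b"
  using n_subsets[of "{1..n}" b] by (simp add: batches_def)

lemma batch_mean_const: "b \<le> n \<Longrightarrow> batch_mean n b (\<lambda>_. c) = c"
  by (simp add: batch_mean_def card_batches)

lemma batch_mean_add:
  "batch_mean n b (\<lambda>S. g S + g' S) = batch_mean n b g + batch_mean n b g'"
  by (simp add: batch_mean_def sum.distrib add_divide_distrib)

lemma batch_mean_cmult: "batch_mean n b (\<lambda>S. c * g S) = c * batch_mean n b g"
  by (simp add: batch_mean_def flip: sum_distrib_left)

lemma batch_mean_mono:
  "(\<And>S. S \<in> batches n b \<Longrightarrow> g S \<le> g' S) \<Longrightarrow> batch_mean n b g \<le> batch_mean n b g'"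
  unfolding batch_mean_def by (intro divide_right_mono sum_mono) auto

lemma batch_mean_cong:
  "(\<And>S. S \<in> batches n b \<Longrightarrow> g S = g' S) \<Longrightarrow> batch_mean n b g = batch_mean n b g'"
  unfolding batch_mean_def by (metis (no_types, lifting) sum.cong)

lemma card_batches_containing:
  assumes "i \<in> {1..n}" "b \<ge> 1"
  shows "card {S \<in> batches n b. i \<in> S} = (n - 1) choose (b - 1)"
proof -
  have "{S \<in> batches n b. i \<notin> S} = {S. S \<subseteq> {1..n} - {i} \<and> card S = b}"
    by (auto simp: batches_def)
  then have out: "card {S \<in> batches n b. i \<notin> S} = (n - 1) choose b"
    using n_subsets[of "{1..n} - {i}" b] assms by simp
  have "card (batches n b) = card {S \<in> batches n b. i \<in> S} + card {S \<in> batches n b. i \<notin> S}"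
    by (subst card_Un_disjoint[symmetric]) (auto intro!: arg_cong[of _ _ card])
  moreover have "n choose b = ((n - 1) choose (b - 1)) + ((n - 1) choose b)"
    using assms by (intro choose_reduce_nat) auto
  ultimately show ?thesis
    using out by (simp add: card_batches)
qed

text \<open>
  Every index lies in the same number \<open>(n - 1) choose (b - 1)\<close> of batches, which is the fraction
  \<open>b / n\<close> of all of them.
\<close>

lemma batch_mean_sum:
  assumes b: "b \<in> {1..n}"
  shows "batch_mean n b (\<lambda>S. \<Sum>i\<in>S. g i) = real b / real n * (\<Sum>i=1..n. g i)"
proof -
  have "(\<Sum>S\<in>batches n b. \<Sum>i\<in>S. g i) = (\<Sum>S\<in>batches n b. \<Sum>i=1..n. if i \<in> S then g i else 0)"
    by (intro sum.cong refl sum.mono_neutral_cong_left) (auto simp: batches_def)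
  also have "\<dots> = (\<Sum>i=1..n. real (card {S \<in> batches n b. i \<in> S}) * g i)"
    by (subst sum.swap) (simp add: sum.If_cases Int_def)
  also have "\<dots> = (\<Sum>i=1..n. real ((n - 1) choose (b - 1)) * g i)"
    using b by (intro sum.cong refl) (simp add: card_batches_containing)
  finally have eq: "(\<Sum>S\<in>batches n b. \<Sum>i\<in>S. g i) = real ((n - 1) choose (b - 1)) * (\<Sum>i=1..n. g i)"
    by (simp add: sum_distrib_left)
  have "b * (n choose b) = n * ((n - 1) choose (b - 1))"
    using b by (intro times_binomial_minus1_eq) auto
  then have "real b * real (n choose b) = real n * real ((n - 1) choose (b - 1))"
    by (metis of_nat_mult)
  moreover have "real (n choose b) \<noteq> 0" "real n \<noteq> 0" using b by auto
  ultimately show ?thesis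
    unfolding batch_mean_def eq by (simp add: field_simps)
qed

text \<open>
  In a Hilbert space the constant would be \<open>1\<close>.  In a general norm there is no Pythagorean identity,
  and the triangle inequality gives \<open>2\<close> for \<open>v i\<close> and another \<open>2\<close> for the mean.
\<close>

lemma sum_norm_centered_le:
  fixes v :: "nat \<Rightarrow> 'c::real_normed_vector"
  assumes vbar_eq: "vbar = (1 / real n) *\<^sub>R (\<Sum>i=1..n. v i)" and "n \<ge> 1"
  shows "(\<Sum>i=1..n. (norm (v i - vbar))\<^sup>2) \<le> 4 * (\<Sum>i=1..n. (norm (v i))\<^sup>2)"
proof -
  have n: "real n > 0" using assms(2) by simp
  have "norm vbar \<le> (1 / real n) * (\<Sum>i=1..n. norm (v i))"
    unfolding vbar_eq by (simp add: divide_right_mono norm_sum)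
  then have "(norm vbar)\<^sup>2 \<le> ((1 / real n) * (\<Sum>i=1..n. norm (v i)))\<^sup>2"
    by (rule power_mono) simp
  also have "\<dots> \<le> (1 / real n)\<^sup>2 * (real n * (\<Sum>i=1..n. (norm (v i))\<^sup>2))"
    using sum_squared_le_sum_of_squares[of "\<lambda>i. norm (v i)" "{1..n}"]
    unfolding power_mult_distrib by (intro mult_left_mono) (simp_all add: mult.commute)
  also have "\<dots> = (\<Sum>i=1..n. (norm (v i))\<^sup>2) / real n"
    using n by (simp add: power2_eq_square)
  finally have vbar: "real n * (norm vbar)\<^sup>2 \<le> (\<Sum>i=1..n. (norm (v i))\<^sup>2)"
    using n by (simp add: field_simps)
  have "(norm (v i - vbar))\<^sup>2 \<le> 2 * (norm (v i))\<^sup>2 + 2 * (norm vbar)\<^sup>2" for i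
  proof -
    have "(norm (v i - vbar))\<^sup>2 \<le> (norm (v i) + norm vbar)\<^sup>2"
      by (intro power_mono norm_triangle_ineq4) simp
    then show ?thesis
      using sum_squares_bound[of "norm (v i)" "norm vbar"] by (simp add: power2_sum)
  qed
  then have "(\<Sum>i=1..n. (norm (v i - vbar))\<^sup>2) \<le> (\<Sum>i=1..n. 2 * (norm (v i))\<^sup>2 + 2 * (norm vbar)\<^sup>2)"
    by (intro sum_mono)
  also have "\<dots> = 2 * (\<Sum>i=1..n. (norm (v i))\<^sup>2) + 2 * (real n * (norm vbar)\<^sup>2)"
    by (simp add: sum.distrib sum_distrib_left)
  finally show ?thesis using vbar by linarith
qed

section \<open>One step of the method with the past fixed\<close>

text \<open>
  The assumption on the variance is phrased with \<open>batch_mean\<close>, the expectation over a uniformly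
  drawn batch, so that this part is free of probability theory.
\<close>

locale finite_sum_problem =
  fixes n b :: nat
    and fs :: "nat \<Rightarrow> 'a::real_normed_vector \<Rightarrow> real"
    and f \<psi> :: "'a \<Rightarrow> real" and h :: "'a \<Rightarrow> ereal"
    and D :: "'a set" and xstar :: 'a and Lup M \<sigma>b :: real
  assumes b: "b \<in> {1..n}"
    and f_eq: "\<And>u. f u = 1 / real n * (\<Sum>i=1..n. fs i u)"
    and fs_diff: "\<And>i u. i \<in> {1..n} \<Longrightarrow> u \<in> D \<Longrightarrow> fs i differentiable (at u)"
    and psi_diff: "\<And>u. \<psi> differentiable (at u)"
    and psi_strong: "\<And>u v. bregman \<psi> u v \<ge> 1 / 2 * (norm (u - v))\<^sup>2"
    and h_pcc: "proper_closed_convex h"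
    and D_convex: "convex D"
    and xstar_D: "xstar \<in> D"
    and xstar_min: "\<And>u. ereal (f xstar) + h xstar \<le> ereal (f u) + h u"
    and constants: "Lup > 0" "M \<ge> 0" "\<sigma>b \<ge> 1"
    and f_upper: "\<And>u v. u \<in> D \<Longrightarrow> v \<in> D \<Longrightarrow>
          f u - f v - blinfun_apply (grad f v) (u - v) \<le> Lup * bregman \<psi> u v"
    and fs_convex: "\<And>i. i \<in> {1..n} \<Longrightarrow> convex_on D (fs i)"
    and fs_cocoercive: "\<And>i u v. i \<in> {1..n} \<Longrightarrow> u \<in> D \<Longrightarrow> v \<in> D \<Longrightarrow>
          (norm (grad (fs i) u - grad (fs i) v))\<^sup>2 \<le> 2 * M * bregman (fs i) u v"
    and batch_variance: "\<And>(v :: nat \<Rightarrow> 'a \<Rightarrow>\<^sub>L real) vbar.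
          vbar = (1 / real n) *\<^sub>R (\<Sum>i=1..n. v i) \<Longrightarrow>
          batch_mean n b (\<lambda>S. (norm ((1 / real b) *\<^sub>R (\<Sum>i\<in>S. v i - vbar)))\<^sup>2)
            \<le> \<sigma>b / (real b * real n) * (\<Sum>i=1..n. (norm (v i - vbar))\<^sup>2)"
begin

text \<open>
  \<open>F u - F x\<^sup>*\<close> as a real number.  Where \<open>h u = \<infinity>\<close> the value is meaningless, since
  \<open>real_of_ereal \<infinity> = 0\<close>.
\<close>

definition gap :: "'a \<Rightarrow> real" where
  "gap u = f u + real_of_ereal (h u) - (f xstar + real_of_ereal (h xstar))"

definition table_gap :: "(nat \<Rightarrow> 'a) \<Rightarrow> real" where
  "table_gap \<phi> = (1 / real n) * (\<Sum>i=1..n. bregman (fs i) (\<phi> i) xstar)"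

text \<open>
  The gradient estimator of the algorithm, with the running mean \<open>\<mu>\<close> replaced by the mean of the
  table of gradients that it maintains.
\<close>

definition saga_gradient :: "'a \<Rightarrow> (nat \<Rightarrow> 'a) \<Rightarrow> nat set \<Rightarrow> 'a \<Rightarrow>\<^sub>L real" where
  "saga_gradient y \<phi> S =
     (1 / real b) *\<^sub>R (\<Sum>i\<in>S. grad (fs i) y - grad (fs i) (\<phi> i))
     + (1 / real n) *\<^sub>R (\<Sum>i=1..n. grad (fs i) (\<phi> i))"

lemma table_gap_cong:
  "(\<And>i. i \<in> {1..n} \<Longrightarrow> \<phi>1 i = \<phi>2 i) \<Longrightarrow> table_gap \<phi>1 = table_gap \<phi>2"
  unfolding table_gap_def by (metis (no_types, lifting) sum.cong)

lemma f_has_derivative: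
  assumes "u \<in> D"
  shows "(f has_derivative blinfun_apply ((1 / real n) *\<^sub>R (\<Sum>i=1..n. grad (fs i) u))) (at u)"
proof -
  have "((\<lambda>w. (1 / real n) *\<^sub>R (\<Sum>i=1..n. fs i w)) has_derivative
         (\<lambda>d. (1 / real n) *\<^sub>R (\<Sum>i=1..n. blinfun_apply (grad (fs i) u) d))) (at u)"
    using assms
    by (intro has_derivative_scaleR_right has_derivative_sum has_derivative_grad fs_diff)
  moreover have "f = (\<lambda>w. (1 / real n) *\<^sub>R (\<Sum>i=1..n. fs i w))"
    by (simp add: f_eq fun_eq_iff)
  moreover have "blinfun_apply ((1 / real n) *\<^sub>R (\<Sum>i=1..n. grad (fs i) u))
      = (\<lambda>d. (1 / real n) *\<^sub>R (\<Sum>i=1..n. blinfun_apply (grad (fs i) u) d))"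
    by (simp add: fun_eq_iff blinfun.bilinear_simps blinfun.sum_left)
  ultimately show ?thesis by simp
qed

lemma grad_f: "u \<in> D \<Longrightarrow> grad f u = (1 / real n) *\<^sub>R (\<Sum>i=1..n. grad (fs i) u)"
  by (intro grad_eqI f_has_derivative)

lemma bregman_f:
  "v \<in> D \<Longrightarrow> bregman f u v = (1 / real n) * (\<Sum>i=1..n. bregman (fs i) u v)"
  by (simp add: bregman_def grad_f f_eq sum_subtractf blinfun.bilinear_simps blinfun.sum_left
      sum.distrib add_divide_distrib algebra_simps diff_divide_distrib)

lemma bregman_fs_nonneg: "i \<in> {1..n} \<Longrightarrow> u \<in> D \<Longrightarrow> v \<in> D \<Longrightarrow> 0 \<le> bregman (fs i) u v"
  using convex_on_above_tangent[OF fs_convex[of i] _ _ has_derivative_grad[OF fs_diff[of i v]], of u]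
  by (simp add: bregman_def)

lemma bregman_f_nonneg: "u \<in> D \<Longrightarrow> v \<in> D \<Longrightarrow> 0 \<le> bregman f u v"
  unfolding bregman_f by (intro mult_nonneg_nonneg sum_nonneg bregman_fs_nonneg) auto

lemma table_gap_nonneg: "(\<And>i. i \<in> {1..n} \<Longrightarrow> \<phi> i \<in> D) \<Longrightarrow> 0 \<le> table_gap \<phi>"
  unfolding table_gap_def by (intro mult_nonneg_nonneg sum_nonneg bregman_fs_nonneg xstar_D) auto

lemma bregman_psi_nonneg: "0 \<le> bregman \<psi> u v"
  by (rule order_trans[OF _ psi_strong]) simp

lemma h_not_MInf: "h u \<noteq> -\<infinity>"
  using h_pcc by (simp add: proper_closed_convex_def)

lemma h_real: "h u \<noteq> \<infinity> \<Longrightarrow> ereal (real_of_ereal (h u)) = h u"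
  using h_not_MInf[of u] by (cases "h u") auto

lemma h_xstar: "h xstar \<noteq> \<infinity>"
  by (rule minimizer_subgradient[OF h_pcc f_has_derivative[OF xstar_D] xstar_min])

text \<open>
  Since \<open>- \<nabla>f(x\<^sup>*)\<close> is a subgradient of \<open>h\<close> at \<open>x\<^sup>*\<close>, the linear part of \<open>f\<close> at \<open>x\<^sup>*\<close> is
  absorbed by \<open>h\<close>.
\<close>

lemma bregman_le_gap:
  assumes u: "h u \<noteq> \<infinity>"
  shows "bregman f u xstar \<le> gap u"
proof -
  have "h xstar - ereal (blinfun_apply (grad f xstar) (u - xstar)) \<le> h u"
    using minimizer_subgradient(2)[OF h_pcc f_has_derivative[OF xstar_D] xstar_min]
    by (simp add: grad_f xstar_D)
  then have "ereal (real_of_ereal (h xstar)) - ereal (blinfun_apply (grad f xstar) (u - xstar))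
      \<le> ereal (real_of_ereal (h u))"
    by (simp add: h_real u h_xstar)
  then show ?thesis
    by (simp add: gap_def bregman_def)
qed

lemma gap_nonneg: "h u \<noteq> \<infinity> \<Longrightarrow> 0 \<le> gap u"
  using xstar_min[of u] h_xstar h_not_MInf[of u] h_not_MInf[of xstar]
  by (cases "h u"; cases "h xstar") (auto simp: gap_def)

lemma saga_error_eq:
  assumes y: "y \<in> D" and S: "S \<in> batches n b"
    and v: "v = (\<lambda>i. grad (fs i) y - grad (fs i) (\<phi> i))"
    and vbar: "vbar = (1 / real n) *\<^sub>R (\<Sum>i=1..n. v i)"
  shows "saga_gradient y \<phi> S - grad f y = (1 / real b) *\<^sub>R (\<Sum>i\<in>S. v i - vbar)"
proof -
  have "card S = b" "b \<noteq> 0"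
    using S b by (auto simp: batches_def)
  then have "(1 / real b) *\<^sub>R (\<Sum>i\<in>S. v i - vbar) = (1 / real b) *\<^sub>R (\<Sum>i\<in>S. v i) - vbar"
    by (simp add: sum_subtractf scaleR_diff_right sum_constant_scaleR)
  then show ?thesis
    by (simp add: saga_gradient_def grad_f y v vbar sum_subtractf scaleR_diff_right)
qed

text \<open>
  Comparing both gradients with the one at \<open>x\<^sup>*\<close> turns the variance into quantities that the
  potential can pay for: cocoercivity bounds each comparison by a Bregman distance to \<open>x\<^sup>*\<close>.
\<close>

lemma gradient_difference_le:
  assumes i: "i \<in> {1..n}" and D: "y \<in> D" "\<phi> i \<in> D"
  shows "(norm (grad (fs i) y - grad (fs i) (\<phi> i)))\<^sup>2
           \<le> 4 * M * (bregman (fs i) y xstar + bregman (fs i) (\<phi> i) xstar)"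
proof -
  let ?g = "grad (fs i) xstar"
  have "norm (grad (fs i) y - grad (fs i) (\<phi> i))
      \<le> norm (grad (fs i) y - ?g) + norm (grad (fs i) (\<phi> i) - ?g)"
    using norm_triangle_ineq4[of "grad (fs i) y - ?g" "grad (fs i) (\<phi> i) - ?g"] by simp
  then have "(norm (grad (fs i) y - grad (fs i) (\<phi> i)))\<^sup>2
      \<le> (norm (grad (fs i) y - ?g) + norm (grad (fs i) (\<phi> i) - ?g))\<^sup>2"
    by (intro power_mono) auto
  also have "\<dots> \<le> 2 * (norm (grad (fs i) y - ?g))\<^sup>2 + 2 * (norm (grad (fs i) (\<phi> i) - ?g))\<^sup>2"
    using sum_squares_bound[of "norm (grad (fs i) y - ?g)" "norm (grad (fs i) (\<phi> i) - ?g)"]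
    by (simp add: power2_sum)
  also have "\<dots> \<le> 2 * (2 * M * bregman (fs i) y xstar) + 2 * (2 * M * bregman (fs i) (\<phi> i) xstar)"
    using fs_cocoercive[OF i D(1) xstar_D] fs_cocoercive[OF i D(2) xstar_D] by linarith
  finally show ?thesis by (simp add: algebra_simps)
qed

lemma sum_gradient_difference_le:
  assumes y: "y \<in> D" and \<phi>: "\<And>i. i \<in> {1..n} \<Longrightarrow> \<phi> i \<in> D"
  shows "(\<Sum>i=1..n. (norm (grad (fs i) y - grad (fs i) (\<phi> i)))\<^sup>2)
           \<le> 4 * M * real n * (bregman f y xstar + table_gap \<phi>)"
proof -
  have "(\<Sum>i=1..n. (norm (grad (fs i) y - grad (fs i) (\<phi> i)))\<^sup>2)
      \<le> (\<Sum>i=1..n. 4 * M * (bregman (fs i) y xstar + bregman (fs i) (\<phi> i) xstar))"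
    using assms by (intro sum_mono gradient_difference_le) auto
  also have "\<dots> = 4 * M * real n * (bregman f y xstar + table_gap \<phi>)"
    using b by (simp add: bregman_f xstar_D table_gap_def sum.distrib
        flip: sum_distrib_left) (simp add: field_simps)
  finally show ?thesis .
qed

text \<open>
  The constant is the product of three factors \<open>4 \<cdot> 2 \<cdot> 2\<close>: centring in a general norm,
  splitting at \<open>x\<^sup>*\<close>, and the \<open>2 M\<close> of cocoercivity.
\<close>

lemma saga_variance:
  assumes y: "y \<in> D" and \<phi>: "\<And>i. i \<in> {1..n} \<Longrightarrow> \<phi> i \<in> D"
  shows "batch_mean n b (\<lambda>S. (norm (grad f y - saga_gradient y \<phi> S))\<^sup>2)
           \<le> 16 * \<sigma>b * M / real b * (bregman f y xstar + table_gap \<phi>)"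
proof -
  define v where "v = (\<lambda>i. grad (fs i) y - grad (fs i) (\<phi> i))"
  define vbar where "vbar = (1 / real n) *\<^sub>R (\<Sum>i=1..n. v i)"
  have pos: "real b > 0" "real n > 0" "\<sigma>b > 0" using b constants by auto
  have "batch_mean n b (\<lambda>S. (norm (grad f y - saga_gradient y \<phi> S))\<^sup>2)
      = batch_mean n b (\<lambda>S. (norm ((1 / real b) *\<^sub>R (\<Sum>i\<in>S. v i - vbar)))\<^sup>2)"
    by (intro batch_mean_cong)
      (metis norm_minus_commute saga_error_eq[OF y _ v_def vbar_def])
  also have "\<dots> \<le> \<sigma>b / (real b * real n) * (\<Sum>i=1..n. (norm (v i - vbar))\<^sup>2)"
    by (intro batch_variance vbar_def)
  also have "\<dots> \<le> \<sigma>b / (real b * real n) * (4 * (\<Sum>i=1..n. (norm (v i))\<^sup>2))"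
    using pos sum_norm_centered_le[OF vbar_def] b by (intro mult_left_mono) auto
  also have "\<dots> \<le> \<sigma>b / (real b * real n) * (4 * (4 * M * real n * (bregman f y xstar + table_gap \<phi>)))"
    using pos sum_gradient_difference_le[OF y \<phi>] unfolding v_def by (intro mult_left_mono) auto
  also have "\<dots> = 16 * \<sigma>b * M / real b * (bregman f y xstar + table_gap \<phi>)"
    using pos by (simp add: field_simps)
  finally show ?thesis .
qed

lemma saga_unbiased:
  assumes y: "y \<in> D"
  shows "batch_mean n b (\<lambda>S. blinfun_apply (grad f y - saga_gradient y \<phi> S) w) = 0"
proof -
  have "blinfun_apply (grad f y - saga_gradient y \<phi> S) w
      = blinfun_apply (grad f y - (1 / real n) *\<^sub>R (\<Sum>i=1..n. grad (fs i) (\<phi> i))) w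
        + (- 1 / real b) * (\<Sum>i\<in>S. blinfun_apply (grad (fs i) y - grad (fs i) (\<phi> i)) w)" for S
    by (simp add: saga_gradient_def blinfun.bilinear_simps blinfun.sum_left)
  note split = this
  have "batch_mean n b (\<lambda>S. blinfun_apply (grad f y - saga_gradient y \<phi> S) w)
      = blinfun_apply (grad f y - (1 / real n) *\<^sub>R (\<Sum>i=1..n. grad (fs i) (\<phi> i))) w
        + (- 1 / real b) * (real b / real n *
            (\<Sum>i=1..n. blinfun_apply (grad (fs i) y - grad (fs i) (\<phi> i)) w))"
    using b unfolding split
    by (simp only: batch_mean_add batch_mean_cmult batch_mean_const batch_mean_sum[OF b] atLeastAtMost_iff)
  also have "\<dots> = 0"
    using b by (simp add: grad_f y blinfun.bilinear_simps blinfun.sum_left sum_subtractf diff_divide_distrib)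
  finally show ?thesis .
qed

text \<open>
  A refresh replaces a proportion \<open>b / n\<close> of the table by \<open>y\<close>, in expectation over the batch.
\<close>

lemma table_gap_update:
  "batch_mean n b (\<lambda>S. table_gap (\<lambda>i. if i \<in> S then y else \<phi> i))
     = real b / real n * bregman f y xstar + (1 - real b / real n) * table_gap \<phi>"
proof -
  let ?d = "\<lambda>i. bregman (fs i) y xstar - bregman (fs i) (\<phi> i) xstar"
  have "table_gap (\<lambda>i. if i \<in> S then y else \<phi> i) = table_gap \<phi> + (1 / real n) * (\<Sum>i\<in>S. ?d i)"
    if S: "S \<in> batches n b" for S
  proof -
    have "(\<Sum>i\<in>S. ?d i) = (\<Sum>i=1..n. if i \<in> S then ?d i else 0)"
      using S by (intro sum.mono_neutral_cong_left) (auto simp: batches_def)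
    moreover have "bregman (fs i) (if i \<in> S then y else \<phi> i) xstar
        = bregman (fs i) (\<phi> i) xstar + (if i \<in> S then ?d i else 0)" for i
      by simp
    ultimately show ?thesis
      unfolding table_gap_def by (simp only: sum.distrib distrib_left)
  qed
  then have "batch_mean n b (\<lambda>S. table_gap (\<lambda>i. if i \<in> S then y else \<phi> i))
      = batch_mean n b (\<lambda>S. table_gap \<phi> + (1 / real n) * (\<Sum>i\<in>S. ?d i))"
    by (rule batch_mean_cong)
  also have "\<dots> = table_gap \<phi> + (1 / real n) * (real b / real n * (\<Sum>i=1..n. ?d i))"
    using b by (simp only: batch_mean_add batch_mean_cmult batch_mean_sum) (simp add: batch_mean_const)
  also have "\<dots> = real b / real n * bregman f y xstar + (1 - real b / real n) * table_gap \<phi>"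
    by (simp add: bregman_f xstar_D table_gap_def sum_subtractf algebra_simps diff_divide_distrib)
  finally show ?thesis .
qed

text \<open>
  The three-point inequality at \<open>u = x\<^sup>*\<close>, with \<open>f p\<close> bounded from above by relative smoothness
  and \<open>f x\<^sup>*\<close> from below by convexity.  The estimator enters only through its error
  \<open>\<nabla>f(y) - G\<close>.
\<close>

lemma prox_step:
  assumes y: "y \<in> D" and p: "p \<in> D" and \<tau>: "0 < \<tau>"
    and min: "is_arg_min (prox_objective h \<psi> G \<tau> y) (\<lambda>_. True) p"
  shows "gap p + 1 / \<tau> * bregman \<psi> xstar p
           \<le> 1 / \<tau> * bregman \<psi> xstar y + blinfun_apply (grad f y - G) (p - xstar)
             + (Lup - 1 / \<tau>) * bregman \<psi> p y"
proof -
  have "ereal (real_of_ereal (h xstar)) \<ge> ereal (real_of_ereal (h p)) + ereal (blinfun_apply G (p - xstar)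
           + 1 / \<tau> * (bregman \<psi> xstar p + bregman \<psi> p y - bregman \<psi> xstar y))"
    using prox_three_point[OF h_pcc psi_diff min] by (simp only: h_real h_xstar not_False_eq_True)
  then have h: "real_of_ereal (h p) + blinfun_apply G (p - xstar)
           + 1 / \<tau> * (bregman \<psi> xstar p + bregman \<psi> p y - bregman \<psi> xstar y) \<le> real_of_ereal (h xstar)"
    by simp
  have "f y + blinfun_apply (grad f y) (xstar - y) \<le> f xstar"
    using bregman_f_nonneg[OF xstar_D y] by (simp add: bregman_def)
  then have "f p - f xstar \<le> blinfun_apply (grad f y) (p - xstar) + Lup * bregman \<psi> p y"
    using f_upper[OF p y] by (simp add: blinfun.bilinear_simps)
  with h show ?thesis
    by (simp add: gap_def blinfun.bilinear_simps algebra_simps)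
qed

text \<open>
  Split the error term of \<open>prox_step\<close> at \<open>y\<close>.  The part against \<open>y - x\<^sup>*\<close> has mean zero because
  \<open>y\<close> does not depend on the batch.  The part against \<open>p - y\<close> is at most
  \<open>\<parallel>e\<parallel>\<^sup>2 / (2 c) + c D\<^sub>\<psi>(p, y)\<close> by Young's inequality and strong convexity.  With
  \<open>c = 32 \<sigma>\<^sub>b M / b\<close> the second summand is paid for by \<open>1 / \<tau> - Lup \<ge> c\<close>, and the mean of the
  first one is at most a quarter of the sum of \<open>D\<^sub>f(y, x\<^sup>*)\<close> and the table gap, by
  \<open>saga_variance\<close>.
\<close>

lemma one_step:
  assumes y: "y \<in> D" and \<phi>: "\<And>i. i \<in> {1..n} \<Longrightarrow> \<phi> i \<in> D"
    and \<tau>: "0 < \<tau>" "\<tau> \<le> 1 / (Lup + 32 * \<sigma>b * M / real b)"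
    and p: "\<And>S. S \<in> batches n b \<Longrightarrow> p S \<in> D"
    and min: "\<And>S. S \<in> batches n b \<Longrightarrow>
          is_arg_min (prox_objective h \<psi> (saga_gradient y \<phi> S) \<tau> y) (\<lambda>_. True) (p S)"
  shows "batch_mean n b (\<lambda>S. gap (p S) + 1 / \<tau> * bregman \<psi> xstar (p S))
           \<le> 1 / 4 * (bregman f y xstar + table_gap \<phi>) + 1 / \<tau> * bregman \<psi> xstar y"
proof -
  define c where "c = 32 * \<sigma>b * M / real b"
  define e where "e S = grad f y - saga_gradient y \<phi> S" for S
  define d where "d = bregman f y xstar + table_gap \<phi>"
  have pos: "real b > 0" "\<sigma>b > 0" using b constants by auto
  have c0: "0 \<le> c" using pos constants by (simp add: c_def)
  have d0: "0 \<le> d"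
    unfolding d_def by (intro add_nonneg_nonneg bregman_f_nonneg y xstar_D table_gap_nonneg \<phi>)
  have c: "c \<le> 1 / \<tau> - Lup"
    using \<tau> c0 constants unfolding c_def[symmetric] by (simp add: field_simps)
  have var: "batch_mean n b (\<lambda>S. (norm (e S))\<^sup>2) \<le> c / 2 * d"
    using saga_variance[of y \<phi>] y \<phi> by (simp add: e_def c_def d_def mult_ac)
  \<comment> \<open>If \<open>M = 0\<close> then \<open>c = 0\<close> and Young's inequality is not available, but the estimator is exact.\<close>
  have e0: "e S = 0" if "S \<in> batches n b" "c = 0" for S
  proof -
    have "(\<Sum>S\<in>batches n b. (norm (e S))\<^sup>2) \<le> 0"
      using var that b by (simp add: batch_mean_def divide_le_0_iff)
    then have "(\<Sum>S\<in>batches n b. (norm (e S))\<^sup>2) = 0"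
      by (intro antisym sum_nonneg) auto
    with that(1) show ?thesis
      by (simp add: sum_nonneg_eq_0_iff)
  qed
  have step: "gap (p S) + 1 / \<tau> * bregman \<psi> xstar (p S)
      \<le> 1 / \<tau> * bregman \<psi> xstar y + (blinfun_apply (e S) (y - xstar) + 1 / (2 * c) * (norm (e S))\<^sup>2)"
    if S: "S \<in> batches n b" for S
  proof -
    let ?r = "norm (p S - y)"
    have "blinfun_apply (e S) (p S - y) \<le> norm (e S) * ?r"
      using norm_blinfun[of "e S" "p S - y"] by simp
    also have "\<dots> \<le> 1 / (2 * c) * (norm (e S))\<^sup>2 + c * (1 / 2 * ?r\<^sup>2)"
    proof (cases "c = 0")
      case False
      then have "0 \<le> (norm (e S) - c * ?r)\<^sup>2 / (2 * c)" using c0 by simp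
      also have "\<dots> = 1 / (2 * c) * (norm (e S))\<^sup>2 + c * (1 / 2 * ?r\<^sup>2) - norm (e S) * ?r"
        using False by (simp add: field_simps power2_eq_square)
      finally show ?thesis by simp
    qed (simp add: e0[OF S])
    also have "\<dots> \<le> 1 / (2 * c) * (norm (e S))\<^sup>2 + c * bregman \<psi> (p S) y"
      using c0 psi_strong[of "p S" y] by (intro add_left_mono mult_left_mono) auto
    also have "\<dots> \<le> 1 / (2 * c) * (norm (e S))\<^sup>2 + (1 / \<tau> - Lup) * bregman \<psi> (p S) y"
      using c bregman_psi_nonneg by (intro add_left_mono mult_right_mono)
    finally have "blinfun_apply (e S) (p S - y) + (Lup - 1 / \<tau>) * bregman \<psi> (p S) y
        \<le> 1 / (2 * c) * (norm (e S))\<^sup>2"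
      by (simp add: algebra_simps)
    moreover have "blinfun_apply (e S) (p S - xstar)
        = blinfun_apply (e S) (p S - y) + blinfun_apply (e S) (y - xstar)"
      by (simp add: blinfun.bilinear_simps)
    ultimately show ?thesis
      using prox_step[OF y p[OF S] \<tau>(1) min[OF S]] by (simp only: e_def)
  qed
  have "1 / (2 * c) * batch_mean n b (\<lambda>S. (norm (e S))\<^sup>2) \<le> 1 / (2 * c) * (c / 2 * d)"
    using var c0 by (intro mult_left_mono) auto
  also have "\<dots> \<le> 1 / 4 * d"
    using d0 by (cases "c = 0") auto
  finally have "1 / (2 * c) * batch_mean n b (\<lambda>S. (norm (e S))\<^sup>2)
      \<le> 1 / 4 * (bregman f y xstar + table_gap \<phi>)" by (simp only: d_def)
  moreover have "batch_mean n b (\<lambda>S. gap (p S) + 1 / \<tau> * bregman \<psi> xstar (p S))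
      \<le> batch_mean n b (\<lambda>S. 1 / \<tau> * bregman \<psi> xstar y
            + (blinfun_apply (e S) (y - xstar) + 1 / (2 * c) * (norm (e S))\<^sup>2))"
    by (rule batch_mean_mono) (rule step)
  moreover have "\<dots> = 1 / \<tau> * bregman \<psi> xstar y
      + (batch_mean n b (\<lambda>S. blinfun_apply (e S) (y - xstar))
         + 1 / (2 * c) * batch_mean n b (\<lambda>S. (norm (e S))\<^sup>2))"
    using b by (simp only: batch_mean_add batch_mean_cmult batch_mean_const atLeastAtMost_iff)
  moreover have "batch_mean n b (\<lambda>S. blinfun_apply (e S) (y - xstar)) = 0"
    unfolding e_def by (rule saga_unbiased[OF y])
  ultimately show ?thesis by linarith
qed

text \<open>
  The weight \<open>n / (4 b)\<close> makes the refresh of the table cost \<open>1/4 D\<^sub>f(y, x\<^sup>*)\<close> and gain \<open>1/4\<close> of the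
  table gap, which cancels the table gap produced by the variance.
\<close>

lemma lyapunov_step:
  assumes y: "y \<in> D" "h y \<noteq> \<infinity>" and \<phi>: "\<And>i. i \<in> {1..n} \<Longrightarrow> \<phi> i \<in> D"
    and \<tau>: "0 < \<tau>" "\<tau> \<le> 1 / (Lup + 32 * \<sigma>b * M / real b)"
    and p: "\<And>S. S \<in> batches n b \<Longrightarrow> p S \<in> D"
    and min: "\<And>S. S \<in> batches n b \<Longrightarrow>
          is_arg_min (prox_objective h \<psi> (saga_gradient y \<phi> S) \<tau> y) (\<lambda>_. True) (p S)"
  shows "batch_mean n b (\<lambda>S. gap (p S)
             + (real n / (4 * real b) * table_gap (\<lambda>i. if i \<in> S then y else \<phi> i)
                + 1 / \<tau> * bregman \<psi> xstar (p S)))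
           \<le> 1 / 2 * gap y + (real n / (4 * real b) * table_gap \<phi> + 1 / \<tau> * bregman \<psi> xstar y)"
proof -
  let ?w = "real n / (4 * real b)"
  have nb: "real n > 0" "real b > 0" using b by auto
  have w: "?w * (real b / real n * bregman f y xstar + (1 - real b / real n) * table_gap \<phi>)
      = 1 / 4 * bregman f y xstar + ?w * table_gap \<phi> - 1 / 4 * table_gap \<phi>"
    using nb by (simp add: field_simps)
  have "batch_mean n b (\<lambda>S. gap (p S)
             + (?w * table_gap (\<lambda>i. if i \<in> S then y else \<phi> i) + 1 / \<tau> * bregman \<psi> xstar (p S)))
      = batch_mean n b (\<lambda>S. gap (p S) + 1 / \<tau> * bregman \<psi> xstar (p S))
        + ?w * batch_mean n b (\<lambda>S. table_gap (\<lambda>i. if i \<in> S then y else \<phi> i))"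
    by (simp only: batch_mean_add batch_mean_cmult ac_simps)
  also have "\<dots> \<le> 1 / 4 * (bregman f y xstar + table_gap \<phi>) + 1 / \<tau> * bregman \<psi> xstar y
      + ?w * (real b / real n * bregman f y xstar + (1 - real b / real n) * table_gap \<phi>)"
    using one_step[OF y(1) \<phi> \<tau> p min] by (simp add: table_gap_update)
  also have "\<dots> = 1 / 2 * bregman f y xstar + (?w * table_gap \<phi> + 1 / \<tau> * bregman \<psi> xstar y)"
    unfolding w by (simp add: algebra_simps)
  also have "\<dots> \<le> 1 / 2 * gap y + (?w * table_gap \<phi> + 1 / \<tau> * bregman \<psi> xstar y)"
    using bregman_le_gap[OF y(2)] by simp
  finally show ?thesis .
qed

end

section \<open>Histories of independent uniform batches\<close>

locale uniform_batches = prob_space P for P :: "'w measure" +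
  fixes B :: "nat \<Rightarrow> 'w \<Rightarrow> nat set" and n b :: nat
  assumes b_le: "b \<in> {1..n}"
    and B_measurable: "\<And>k. B k \<in> measurable P (count_space (batches n b))"
    and B_uniform: "\<And>k S. S \<in> batches n b \<Longrightarrow>
          AE \<omega> in P. real_cond_exp P (batch_history P B k) (indicator {\<omega>. B k \<omega> = S}) \<omega>
                       = 1 / real (n choose b)"
begin

text \<open>
  Lists take only finitely many values here, which makes every function of a history integrable,
  and appending a batch is one step of the conditioning.
\<close>

definition history :: "nat \<Rightarrow> 'w \<Rightarrow> nat set list" where
  "history k \<omega> = map (\<lambda>j. B j \<omega>) [0..<k]"

definition histories :: "nat \<Rightarrow> nat set list set" where
  "histories k = {H. set H \<subseteq> batches n b \<and> length H = k}"

lemma finite_histories: "finite (histories k)"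
  unfolding histories_def by (rule finite_lists_length_eq) simp

lemma B_in_batches: "\<omega> \<in> space P \<Longrightarrow> B k \<omega> \<in> batches n b"
  using measurable_space[OF B_measurable] by simp

lemma history_in_histories: "\<omega> \<in> space P \<Longrightarrow> history k \<omega> \<in> histories k"
  using B_in_batches by (auto simp: history_def histories_def)

lemma history_Suc: "history (Suc k) \<omega> = history k \<omega> @ [B k \<omega>]"
  by (simp add: history_def)

lemma take_history: "j \<le> k \<Longrightarrow> take j (history k \<omega>) = history j \<omega>"
  by (simp add: history_def take_map)

lemma sets_batch_history:
  "sets (batch_history P B k) = sigma_sets (space P) {B j -` A \<inter> space P | j A. j < k}"
  unfolding batch_history_def by (rule sets_measure_of) auto

lemma space_batch_history: "space (batch_history P B k) = space P"
  unfolding batch_history_def by (rule space_measure_of) auto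

lemma B_vimage_sets: "B j -` A \<inter> space P \<in> sets P"
proof -
  have "B j -` A \<inter> space P = B j -` (A \<inter> batches n b) \<inter> space P"
    using B_in_batches by auto
  then show ?thesis
    using measurable_sets[OF B_measurable, of "A \<inter> batches n b" j] by simp
qed

lemma subalgebra_batch_history: "subalgebra P (batch_history P B k)"
  unfolding subalgebra_def sets_batch_history space_batch_history
  by (intro conjI refl sets.sigma_sets_subset) (auto simp: B_vimage_sets)

lemma sigma_finite_batch_history: "sigma_finite_subalgebra P (batch_history P B k)"
proof (rule finite_measure_subalgebra_is_sigma_finite)
  show "finite_measure_subalgebra P (batch_history P B k)"
    by unfold_locales (rule subalgebra_batch_history)
qed

lemma history_measurable: "history k \<in> measurable (batch_history P B k) (count_space (histories k))"
proof -
  have "history k -` {H} \<inter> space P \<in> sets (batch_history P B k)" if H: "H \<in> histories k" for H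
  proof -
    have eq: "history k \<omega> = H \<longleftrightarrow> (\<forall>j\<in>{..<k}. B j \<omega> = H ! j)" for \<omega>
      using H by (simp add: history_def histories_def list_eq_iff_nth_eq lessThan_def)
    have "{\<omega> \<in> space (batch_history P B k). B j \<omega> = H ! j} \<in> sets (batch_history P B k)"
      if "j \<in> {..<k}" for j
    proof -
      have "B j -` {H ! j} \<inter> space P \<in> sets (batch_history P B k)"
        unfolding sets_batch_history using that by (intro sigma_sets.Basic) auto
      also have "B j -` {H ! j} \<inter> space P = {\<omega> \<in> space (batch_history P B k). B j \<omega> = H ! j}"
        unfolding space_batch_history by blast
      finally show ?thesis .
    qed
    then have "{\<omega> \<in> space (batch_history P B k). \<forall>j\<in>{..<k}. B j \<omega> = H ! j}
        \<in> sets (batch_history P B k)"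
      by (intro sets.sets_Collect_finite_All) auto
    also have "{\<omega> \<in> space (batch_history P B k). \<forall>j\<in>{..<k}. B j \<omega> = H ! j} = history k -` {H} \<inter> space P"
      unfolding space_batch_history using eq by blast
    finally show ?thesis .
  qed
  then show ?thesis
    by (simp add: measurable_count_space_eq2 finite_histories space_batch_history history_in_histories)
qed

lemma history_fun_measurable:
  fixes z :: "nat set list \<Rightarrow> real"
  shows "(\<lambda>\<omega>. z (history k \<omega>)) \<in> borel_measurable (batch_history P B k)"
  by (rule measurable_compose[OF history_measurable]) simp

lemma history_integrable:
  fixes z :: "nat set list \<Rightarrow> real"
  shows "integrable P (\<lambda>\<omega>. z (history k \<omega>))"
proof (rule integrable_const_bound)
  show "(\<lambda>\<omega>. z (history k \<omega>)) \<in> borel_measurable P"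
    by (rule measurable_from_subalg[OF subalgebra_batch_history history_fun_measurable])
  show "AE \<omega> in P. norm (z (history k \<omega>)) \<le> (\<Sum>H\<in>histories k. norm (z H))"
    by (intro AE_I2 member_le_sum[where f = "\<lambda>H. norm (z H)"] history_in_histories finite_histories) auto
qed

text \<open>
  The tower property.  On the event that the last batch is \<open>S\<close>, the variable is a function of the
  earlier batches, and given these the event has probability \<open>1 / (n choose b)\<close>.
\<close>

lemma expectation_history_Suc:
  fixes z :: "nat set list \<Rightarrow> real"
  shows "expectation (\<lambda>\<omega>. z (history (Suc k) \<omega>))
           = expectation (\<lambda>\<omega>. batch_mean n b (\<lambda>S. z (history k \<omega> @ [S])))"
proof -
  interpret sigma_finite_subalgebra P "batch_history P B k"
    by (rule sigma_finite_batch_history)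
  have ind: "(indicator {\<omega>. B k \<omega> = S} :: 'w \<Rightarrow> real) \<in> borel_measurable P" for S
    by (rule iffD2[OF measurable_cong borel_measurable_indicator[OF B_vimage_sets[of k "{S}"]]])
      (simp add: indicator_def)
  have int: "integrable P (\<lambda>\<omega>. z (history k \<omega> @ [S]) * indicator {\<omega>. B k \<omega> = S} \<omega>)" for S
  proof (rule Bochner_Integration.integrable_bound[OF history_integrable[of "\<lambda>H. z (H @ [S])" k]])
    show "(\<lambda>\<omega>. z (history k \<omega> @ [S]) * indicator {\<omega>. B k \<omega> = S} \<omega>) \<in> borel_measurable P"
      by (intro borel_measurable_times ind
          borel_measurable_integrable[OF history_integrable[of "\<lambda>H. z (H @ [S])" k]])
  qed (simp add: indicator_def)
  have one: "expectation (\<lambda>\<omega>. z (history k \<omega> @ [S]) * indicator {\<omega>. B k \<omega> = S} \<omega>)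
      = expectation (\<lambda>\<omega>. z (history k \<omega> @ [S]) * (1 / real (n choose b)))"
    if S: "S \<in> batches n b" for S
  proof -
    have "expectation (\<lambda>\<omega>. z (history k \<omega> @ [S]) * indicator {\<omega>. B k \<omega> = S} \<omega>)
        = expectation (\<lambda>\<omega>. z (history k \<omega> @ [S])
            * real_cond_exp P (batch_history P B k) (indicator {\<omega>. B k \<omega> = S}) \<omega>)"
      by (intro real_cond_exp_intg(2)[symmetric] int ind history_fun_measurable[of "\<lambda>H. z (H @ [S])"])
    also have "\<dots> = expectation (\<lambda>\<omega>. z (history k \<omega> @ [S]) * (1 / real (n choose b)))"
      using B_uniform[OF S, of k]
      by (intro integral_cong_AE borel_measurable_times borel_measurable_const borel_measurable_cond_exp2
          borel_measurable_integrable[OF history_integrable[of "\<lambda>H. z (H @ [S])" k]]) auto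
    finally show ?thesis .
  qed
  have "z (history (Suc k) \<omega>) = (\<Sum>S\<in>batches n b. z (history k \<omega> @ [S]) * indicator {\<omega>. B k \<omega> = S} \<omega>)"
    if "\<omega> \<in> space P" for \<omega>
    using B_in_batches[OF that, of k]
    by (simp add: history_Suc indicator_def sum.delta' if_distrib cong: if_cong)
  then have "expectation (\<lambda>\<omega>. z (history (Suc k) \<omega>))
      = expectation (\<lambda>\<omega>. \<Sum>S\<in>batches n b. z (history k \<omega> @ [S]) * indicator {\<omega>. B k \<omega> = S} \<omega>)"
    by (rule Bochner_Integration.integral_cong[OF refl])
  also have "\<dots> = (\<Sum>S\<in>batches n b. expectation (\<lambda>\<omega>. z (history k \<omega> @ [S]) * (1 / real (n choose b))))"
    by (simp only: Bochner_Integration.integral_sum int one cong: sum.cong)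
  also have "\<dots> = expectation (\<lambda>\<omega>. \<Sum>S\<in>batches n b. z (history k \<omega> @ [S]) * (1 / real (n choose b)))"
    by (intro Bochner_Integration.integral_sum[symmetric] integrable_mult_left history_integrable[of "\<lambda>H. z (H @ [_])"])
  also have "\<dots> = expectation (\<lambda>\<omega>. batch_mean n b (\<lambda>S. z (history k \<omega> @ [S])))"
    by (simp add: batch_mean_def flip: sum_divide_distrib)
  finally show ?thesis .
qed

lemma expectation_batch:
  "expectation (\<lambda>\<omega>. g (B k \<omega>)) = batch_mean n b g"
  using expectation_history_Suc[of "\<lambda>H. g (last H)" k] prob_space
  by (simp add: history_Suc)

text \<open>
  Every history has positive probability, since each further batch divides the probability by
  \<open>n choose b\<close>.  Hence almost sure properties hold on some outcome with any prescribed history.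
\<close>

lemma history_charged:
  assumes "AE \<omega> in P. Q \<omega>" "H \<in> histories k"
  shows "\<exists>\<omega>\<in>space P. Q \<omega> \<and> history k \<omega> = H"
proof -
  have "0 < expectation (\<lambda>\<omega>. if history k \<omega> = H then 1 else 0 :: real)"
    using assms(2)
  proof (induction k arbitrary: H)
    case 0
    then show ?case using prob_space by (simp add: history_def histories_def)
  next
    case (Suc k)
    obtain H' S where H: "H = H' @ [S]" "H' \<in> histories k" "S \<in> batches n b"
      using Suc.prems by (cases H rule: rev_cases) (auto simp: histories_def)
    have "batch_mean n b (\<lambda>S'. if history k \<omega> @ [S'] = H then 1 else 0)
        = (1 / real (n choose b)) * (if history k \<omega> = H' then 1 else 0 :: real)" for \<omega>
      using H(3) by (simp add: batch_mean_def H(1))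
    then have "expectation (\<lambda>\<omega>. if history (Suc k) \<omega> = H then 1 else 0 :: real)
        = (1 / real (n choose b)) * expectation (\<lambda>\<omega>. if history k \<omega> = H' then 1 else 0 :: real)"
      using expectation_history_Suc[of "\<lambda>L. if L = H then 1 else 0" k] by simp
    with Suc.IH[OF H(2)] b_le show ?case by simp
  qed
  moreover have "expectation (\<lambda>\<omega>. if history k \<omega> = H then 1 else 0 :: real) = 0"
    if "\<not> ?thesis"
  proof -
    have "AE \<omega> in P. (if history k \<omega> = H then 1 else 0 :: real) = 0"
      using assms(1) AE_space by eventually_elim (use that in auto)
    then show ?thesis
      using integral_cong_AE[of "\<lambda>\<omega>. if history k \<omega> = H then 1 else 0 :: real" P "\<lambda>_. 0"]
        borel_measurable_integrable[OF history_integrable[of "\<lambda>L. if L = H then 1 else 0" k]] by simp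
  qed
  ultimately show ?thesis by fastforce
qed

end

text \<open>
  The nonnegative integral ignores null sets even for functions that are not measurable.  This
  allows the objective at the averaged iterate to be replaced by a function of the history.
\<close>

lemma ereal_expectation_cong_AE:
  assumes "AE \<omega> in P. X \<omega> = Y \<omega>"
  shows "ereal_expectation P X = ereal_expectation P Y"
proof -
  have "(\<integral>\<^sup>+\<omega>. e2ennreal (X \<omega>) \<partial>P) = (\<integral>\<^sup>+\<omega>. e2ennreal (Y \<omega>) \<partial>P)"
    "(\<integral>\<^sup>+\<omega>. e2ennreal (- X \<omega>) \<partial>P) = (\<integral>\<^sup>+\<omega>. e2ennreal (- Y \<omega>) \<partial>P)"
    using assms by (auto intro!: nn_integral_cong_AE elim!: eventually_mono)
  then show ?thesis by (simp add: ereal_expectation_def)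
qed

section \<open>Descent along the histories of the algorithm\<close>

text \<open>
  Uniqueness of the proximal point is what makes the state a function of the earlier batches.
\<close>

lemma ada_bpsg_run_nonanticipating:
  assumes run: "ada_bpsg_run n fs h \<psi> b x0 \<eta>min \<eta>max \<eta>0 m \<alpha> \<theta> B x \<phi> \<eta> \<xi> \<delta> \<mu>"
    and run': "ada_bpsg_run n fs h \<psi> b x0 \<eta>min \<eta>max \<eta>0 m \<alpha> \<theta> B' x' \<phi>' \<eta>' \<xi>' \<delta>' \<mu>'"
    and B: "\<And>k. B k \<subseteq> {1..n}"
    and unique: "\<And>k G. \<exists>!v. is_arg_min (prox_objective h \<psi> G (\<eta> k) (x k)) (\<lambda>_. True) v"
    and same: "\<And>j. j < k \<Longrightarrow> B j = B' j"
  shows "x k = x' k \<and> (\<forall>i\<in>{1..n}. \<phi> k i = \<phi>' k i) \<and> \<eta> k = \<eta>' k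
           \<and> \<xi> k = \<xi>' k \<and> \<delta> k = \<delta>' k \<and> \<mu> k = \<mu>' k"
  using same
proof (induction k)
  case 0
  have "(\<Sum>i=1..n. grad (fs i) (\<phi> 0 i)) = (\<Sum>i=1..n. grad (fs i) (\<phi>' 0 i))"
    using run run' by (intro sum.cong refl) (auto simp: ada_bpsg_run_def)
  then show ?case
    using run run' by (auto simp: ada_bpsg_run_def)
next
  case (Suc k)
  then have IH: "x k = x' k" "\<And>i. i \<in> {1..n} \<Longrightarrow> \<phi> k i = \<phi>' k i" "\<eta> k = \<eta>' k"
      "\<xi> k = \<xi>' k" "\<delta> k = \<delta>' k" "\<mu> k = \<mu>' k" and Bk: "B k = B' k"
    by auto
  have \<phi>: "\<phi> (Suc k) i = \<phi>' (Suc k) i" if "i \<in> {1..n}" for i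
    using run run' that IH(1,2) Bk by (simp add: ada_bpsg_run_def)
  define y where "y i = grad (fs i) (\<phi> (Suc k) i) - grad (fs i) (\<phi> k i)" for i
  define y' where "y' i = grad (fs i) (\<phi>' (Suc k) i) - grad (fs i) (\<phi>' k i)" for i
  define s where "s i = \<phi> (Suc k) i - \<phi> k i" for i
  define s' where "s' i = \<phi>' (Suc k) i - \<phi>' k i" for i
  have ys: "y i = y' i" "s i = s' i" if "i \<in> B k" for i
    using that B[of k] IH(2) \<phi> by (auto simp: y_def y'_def s_def s'_def)
  have sums: "(\<Sum>i\<in>B k. y i) = (\<Sum>i\<in>B k. y' i)"
      "(\<Sum>i\<in>B k. \<bar>blinfun_apply (y i) (s i)\<bar>) = (\<Sum>i\<in>B k. \<bar>blinfun_apply (y' i) (s' i)\<bar>)"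
      "(\<Sum>i\<in>B k. (norm (y i))\<^sup>2) = (\<Sum>i\<in>B k. (norm (y' i))\<^sup>2)"
    by (auto simp: ys intro!: sum.cong)
  have "is_arg_min (prox_objective h \<psi> ((1 / real b) *\<^sub>R (\<Sum>i\<in>B k. y i) + \<mu> k) (\<eta> k) (x k))
          (\<lambda>_. True) (x (Suc k))"
    "\<xi> (Suc k) = (if k > 0 \<and> k mod m = 0 then 0 else \<xi> k) + (\<Sum>i\<in>B k. \<bar>blinfun_apply (y i) (s i)\<bar>)"
    "\<delta> (Suc k) = (if k > 0 \<and> k mod m = 0 then 0 else \<delta> k) + (\<Sum>i\<in>B k. (norm (y i))\<^sup>2)"
    "\<mu> (Suc k) = \<mu> k + (1 / real n) *\<^sub>R (\<Sum>i\<in>B k. y i)"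
    "\<eta> (Suc k) = next_step_size \<eta>min \<eta>max m \<alpha> \<theta> (Suc k) (\<eta> k) (\<xi> (Suc k)) (\<delta> (Suc k))"
    using run unfolding ada_bpsg_run_def Let_def y_def s_def by blast+
  note step = this
  have "is_arg_min (prox_objective h \<psi> ((1 / real b) *\<^sub>R (\<Sum>i\<in>B' k. y' i) + \<mu>' k) (\<eta>' k) (x' k))
          (\<lambda>_. True) (x' (Suc k))"
    "\<xi>' (Suc k) = (if k > 0 \<and> k mod m = 0 then 0 else \<xi>' k) + (\<Sum>i\<in>B' k. \<bar>blinfun_apply (y' i) (s' i)\<bar>)"
    "\<delta>' (Suc k) = (if k > 0 \<and> k mod m = 0 then 0 else \<delta>' k) + (\<Sum>i\<in>B' k. (norm (y' i))\<^sup>2)"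
    "\<mu>' (Suc k) = \<mu>' k + (1 / real n) *\<^sub>R (\<Sum>i\<in>B' k. y' i)"
    "\<eta>' (Suc k) = next_step_size \<eta>min \<eta>max m \<alpha> \<theta> (Suc k) (\<eta>' k) (\<xi>' (Suc k)) (\<delta>' (Suc k))"
    using run' unfolding ada_bpsg_run_def Let_def y'_def s'_def by blast+
  note step' = this[folded Bk IH(1,3-6)]
  have "\<xi> (Suc k) = \<xi>' (Suc k)" "\<delta> (Suc k) = \<delta>' (Suc k)" "\<mu> (Suc k) = \<mu>' (Suc k)"
    using step(2-4) step'(2-4) sums by simp_all
  moreover from this have "\<eta> (Suc k) = \<eta>' (Suc k)"
    using step(5) step'(5) by simp
  moreover have "x (Suc k) = x' (Suc k)"
    using step(1) step'(1) unique unfolding sums(1) by blast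
  ultimately show ?case using \<phi> by blast
qed

text \<open>
  By induction \<open>\<mu> k\<close> is the mean of the table of gradients, because indices outside the batch
  contribute zero to the increments.
\<close>

lemma (in finite_sum_problem) ada_bpsg_run_prox:
  assumes run: "ada_bpsg_run n fs h \<psi> b x0 \<eta>min \<eta>max \<eta>0 m \<alpha> \<theta> B x \<phi> \<eta> \<xi> \<delta> \<mu>"
    and B: "\<And>k. B k \<in> batches n b"
  shows "is_arg_min (prox_objective h \<psi> (saga_gradient (x k) (\<phi> k) (B k)) (\<eta> k) (x k))
           (\<lambda>_. True) (x (Suc k))"
proof -
  define y where "y k i = grad (fs i) (\<phi> (Suc k) i) - grad (fs i) (\<phi> k i)" for k i
  have sub: "B k \<subseteq> {1..n}" for k using B by (auto simp: batches_def)
  have \<phi>: "\<phi> (Suc k) i = (if i \<in> B k then x k else \<phi> k i)" if "i \<in> {1..n}" for k i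
    using run that by (simp add: ada_bpsg_run_def)
  have \<mu>_Suc: "\<mu> (Suc k) = \<mu> k + (1 / real n) *\<^sub>R (\<Sum>i\<in>B k. y k i)" for k
    using run unfolding ada_bpsg_run_def Let_def y_def by blast
  have \<mu>: "\<mu> k = (1 / real n) *\<^sub>R (\<Sum>i=1..n. grad (fs i) (\<phi> k i))" for k
  proof (induction k)
    case 0
    show ?case using run by (simp add: ada_bpsg_run_def)
  next
    case (Suc k)
    have "(\<Sum>i\<in>B k. y k i) = (\<Sum>i=1..n. y k i)"
      using sub by (intro sum.mono_neutral_left) (auto simp: y_def \<phi>)
    then show ?case
      unfolding \<mu>_Suc Suc.IH by (simp add: y_def sum_subtractf flip: scaleR_add_right)
  qed
  have "(\<Sum>i\<in>B k. y k i) = (\<Sum>i\<in>B k. grad (fs i) (x k) - grad (fs i) (\<phi> k i))"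
    using sub[of k] by (intro sum.cong refl) (auto simp: y_def \<phi>)
  then have "saga_gradient (x k) (\<phi> k) (B k) = (1 / real b) *\<^sub>R (\<Sum>i\<in>B k. y k i) + \<mu> k"
    by (simp add: saga_gradient_def \<mu>)
  moreover have "is_arg_min (prox_objective h \<psi> ((1 / real b) *\<^sub>R (\<Sum>i\<in>B k. y k i) + \<mu> k) (\<eta> k) (x k))
          (\<lambda>_. True) (x (Suc k))"
    using run unfolding ada_bpsg_run_def Let_def y_def by blast
  ultimately show ?thesis by simp
qed

text \<open>
  Jensen's inequality: for \<open>h\<close> it is convexity of the epigraph, and for \<open>f\<close> the average of the
  tangent inequalities at \<open>a\<close>, whose linear terms cancel.
\<close>

lemma (in finite_sum_problem) gap_average:
  assumes K: "K \<ge> 1" and x: "\<And>k. k \<in> {1..K} \<Longrightarrow> x k \<in> D \<and> h (x k) \<noteq> \<infinity>"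
    and a: "a = (1 / real K) *\<^sub>R (\<Sum>k=1..K. x k)"
  shows "h a \<noteq> \<infinity>" "gap a \<le> (1 / real K) * (\<Sum>k=1..K. gap (x k))"
proof -
  let ?r = "\<lambda>u. real_of_ereal (h u)"
  have one: "(\<Sum>k=1..K. 1 / real K) = 1" using K by simp
  have aD: "a \<in> D"
    using convex_sum[OF _ D_convex one, of x] x by (simp add: a scaleR_sum_right)
  have "convex (ereal_epigraph h)"
    using h_pcc by (simp add: proper_closed_convex_def)
  then have "(\<Sum>k=1..K. (1 / real K) *\<^sub>R (x k, ?r (x k))) \<in> ereal_epigraph h"
    using x one by (intro convex_sum) (auto simp: ereal_epigraph_def h_real)
  then have "(a, (1 / real K) * (\<Sum>k=1..K. ?r (x k))) \<in> ereal_epigraph h"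
    by (simp add: a scaleR_sum_right sum_prod sum_distrib_left)
  then have ha: "h a \<le> ereal ((1 / real K) * (\<Sum>k=1..K. ?r (x k)))"
    by (simp add: ereal_epigraph_def)
  then show fin: "h a \<noteq> \<infinity>" by auto
  have hr: "?r a \<le> (1 / real K) * (\<Sum>k=1..K. ?r (x k))"
    using ha h_real[OF fin] by (metis ereal_less_eq(3))
  have "(\<Sum>k=1..K. f a + blinfun_apply (grad f a) (x k - a)) \<le> (\<Sum>k=1..K. f (x k))"
  proof (rule sum_mono)
    fix k assume "k \<in> {1..K}"
    then show "f a + blinfun_apply (grad f a) (x k - a) \<le> f (x k)"
      using bregman_f_nonneg[of "x k" a] x aD by (simp add: bregman_def)
  qed
  moreover have "(\<Sum>k=1..K. f a + blinfun_apply (grad f a) (x k - a))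
      = real K * f a + blinfun_apply (grad f a) ((\<Sum>k=1..K. x k) - real K *\<^sub>R a)"
    by (simp add: sum.distrib blinfun.bilinear_simps blinfun.sum_right sum_subtractf)
  moreover have "(\<Sum>k=1..K. x k) - real K *\<^sub>R a = 0"
    using K by (simp add: a)
  ultimately have "real K * f a \<le> (\<Sum>k=1..K. f (x k))"
    by (simp only: blinfun.zero_right add_0_right)
  then have "f a \<le> (1 / real K) * (\<Sum>k=1..K. f (x k))"
    using K by (simp add: field_simps)
  moreover have "(1 / real K) * (\<Sum>k=1..K. gap (x k))
      = (1 / real K) * (\<Sum>k=1..K. f (x k)) + (1 / real K) * (\<Sum>k=1..K. ?r (x k)) - (f xstar + ?r xstar)"
    using K by (simp add: gap_def sum.distrib sum_subtractf field_simps)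
  ultimately show "gap a \<le> (1 / real K) * (\<Sum>k=1..K. gap (x k))"
    using hr by (simp add: gap_def)
qed

locale ada_bpsg =
  finite_sum_problem n b fs f \<psi> h D xstar Lup M \<sigma>b + uniform_batches P B n b
  for n b fs f \<psi> and h :: "'a::real_normed_vector \<Rightarrow> ereal" and D xstar Lup M \<sigma>b
    and P :: "'w measure" and B +
  fixes x0 :: 'a and \<eta>min \<eta>max \<eta>0 \<alpha> \<theta> :: real and m :: nat
    and x :: "nat \<Rightarrow> 'w \<Rightarrow> 'a" and \<phi> :: "nat \<Rightarrow> nat \<Rightarrow> 'w \<Rightarrow> 'a"
    and \<eta> \<xi> \<delta> :: "nat \<Rightarrow> 'w \<Rightarrow> real" and \<mu> :: "nat \<Rightarrow> 'w \<Rightarrow> ('a \<Rightarrow>\<^sub>L real)"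
  assumes \<eta>min_pos: "0 < \<eta>min"
    and \<eta>max_le: "\<eta>max \<le> 1 / (Lup + 32 * \<sigma>b * M / real b)"
    and prox_unique: "\<And>u G \<tau>. u \<in> D \<Longrightarrow> \<tau> \<in> {\<eta>min..\<eta>max} \<Longrightarrow>
          \<exists>!v. is_arg_min (prox_objective h \<psi> G \<tau> u) (\<lambda>_. True) v"
    and AE_run: "AE \<omega> in P. ada_bpsg_run n fs h \<psi> b x0 \<eta>min \<eta>max \<eta>0 m \<alpha> \<theta>
          (\<lambda>k. B k \<omega>) (\<lambda>k. x k \<omega>) (\<lambda>k i. \<phi> k i \<omega>)
          (\<lambda>k. \<eta> k \<omega>) (\<lambda>k. \<xi> k \<omega>) (\<lambda>k. \<delta> k \<omega>) (\<lambda>k. \<mu> k \<omega>)"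
    and AE_in_D: "AE \<omega> in P. \<forall>k. x k \<omega> \<in> D \<and> (\<forall>i\<in>{1..n}. \<phi> k i \<omega> \<in> D)"
    and AE_steps: "AE \<omega> in P. \<forall>k. \<eta>min \<le> \<eta> k \<omega> \<and> \<eta> k \<omega> \<le> \<eta>max"
    and AE_steps_mono: "AE \<omega> in P. \<forall>k\<ge>1. \<eta> k \<omega> \<ge> \<eta> (k - 1) \<omega>"
begin

definition regular :: "'w \<Rightarrow> bool" where
  "regular \<omega> \<longleftrightarrow> \<omega> \<in> space P \<and>
     ada_bpsg_run n fs h \<psi> b x0 \<eta>min \<eta>max \<eta>0 m \<alpha> \<theta>
       (\<lambda>k. B k \<omega>) (\<lambda>k. x k \<omega>) (\<lambda>k i. \<phi> k i \<omega>)
       (\<lambda>k. \<eta> k \<omega>) (\<lambda>k. \<xi> k \<omega>) (\<lambda>k. \<delta> k \<omega>) (\<lambda>k. \<mu> k \<omega>) \<and>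
     (\<forall>k. x k \<omega> \<in> D \<and> (\<forall>i\<in>{1..n}. \<phi> k i \<omega> \<in> D)) \<and>
     (\<forall>k. \<eta>min \<le> \<eta> k \<omega> \<and> \<eta> k \<omega> \<le> \<eta>max \<and> \<eta> k \<omega> \<le> \<eta> (Suc k) \<omega>)"

lemma AE_regular: "AE \<omega> in P. regular \<omega>"
  using AE_run AE_in_D AE_steps AE_steps_mono AE_space
proof eventually_elim
  case (elim \<omega>)
  have "\<eta> k \<omega> \<le> \<eta> (Suc k) \<omega>" for k
    using elim(4)[rule_format, of "Suc k"] by simp
  with elim show ?case by (simp add: regular_def)
qed

lemma regularD:
  assumes "regular \<omega>"
  shows "\<omega> \<in> space P"
    and "ada_bpsg_run n fs h \<psi> b x0 \<eta>min \<eta>max \<eta>0 m \<alpha> \<theta>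
       (\<lambda>k. B k \<omega>) (\<lambda>k. x k \<omega>) (\<lambda>k i. \<phi> k i \<omega>)
       (\<lambda>k. \<eta> k \<omega>) (\<lambda>k. \<xi> k \<omega>) (\<lambda>k. \<delta> k \<omega>) (\<lambda>k. \<mu> k \<omega>)"
    and "x k \<omega> \<in> D" "i \<in> {1..n} \<Longrightarrow> \<phi> k i \<omega> \<in> D"
    and "\<eta>min \<le> \<eta> k \<omega>" "\<eta> k \<omega> \<le> \<eta>max" "\<eta> k \<omega> \<le> \<eta> (Suc k) \<omega>"
  using assms by (auto simp: regular_def)

lemma regular_prox:
  assumes "regular \<omega>"
  shows "is_arg_min (prox_objective h \<psi> (saga_gradient (x k \<omega>) (\<lambda>i. \<phi> k i \<omega>) (B k \<omega>)) (\<eta> k \<omega>) (x k \<omega>))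
           (\<lambda>_. True) (x (Suc k) \<omega>)"
  using ada_bpsg_run_prox[OF regularD(2)[OF assms]] B_in_batches[OF regularD(1)[OF assms]] by simp

lemma regular_h_finite: "regular \<omega> \<Longrightarrow> k \<ge> 1 \<Longrightarrow> h (x k \<omega>) \<noteq> \<infinity>"
  using prox_three_point(1)[OF h_pcc psi_diff regular_prox[of \<omega> "k - 1"]] by simp

lemma regular_eq:
  assumes r: "regular \<omega>" "regular \<omega>'" and H: "history k \<omega> = history k \<omega>'"
  shows "x k \<omega> = x k \<omega>'" "i \<in> {1..n} \<Longrightarrow> \<phi> k i \<omega> = \<phi> k i \<omega>'" "\<eta> k \<omega> = \<eta> k \<omega>'"
proof -
  have "B j \<omega> \<subseteq> {1..n}" for j
    using B_in_batches[OF regularD(1)[OF r(1)]] by (auto simp: batches_def)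
  moreover have "\<exists>!v. is_arg_min (prox_objective h \<psi> G (\<eta> j \<omega>) (x j \<omega>)) (\<lambda>_. True) v" for j G
    using regularD[OF r(1)] by (intro prox_unique) auto
  moreover have "B j \<omega> = B j \<omega>'" if "j < k" for j
    using H that by (simp add: history_def list_eq_iff_nth_eq)
  ultimately have "x k \<omega> = x k \<omega>' \<and> (\<forall>i\<in>{1..n}. \<phi> k i \<omega> = \<phi> k i \<omega>') \<and> \<eta> k \<omega> = \<eta> k \<omega>'"
    using ada_bpsg_run_nonanticipating[OF regularD(2)[OF r(1)] regularD(2)[OF r(2)], of k] by blast
  then show "x k \<omega> = x k \<omega>'" "i \<in> {1..n} \<Longrightarrow> \<phi> k i \<omega> = \<phi> k i \<omega>'" "\<eta> k \<omega> = \<eta> k \<omega>'"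
    by auto
qed

text \<open>
  A representative outcome for each history.  It makes the iterates functions on the finite set of
  histories; as functions on the probability space they need not be measurable.
\<close>

definition outcome :: "nat set list \<Rightarrow> 'w" where
  "outcome H = (SOME \<omega>. regular \<omega> \<and> history (length H) \<omega> = H)"

lemma outcome:
  assumes "H \<in> histories k"
  shows "regular (outcome H)" "history k (outcome H) = H"
proof -
  have "\<exists>\<omega>. regular \<omega> \<and> history k \<omega> = H"
    using history_charged[OF AE_regular assms] by blast
  moreover have "length H = k" using assms by (simp add: histories_def)
  ultimately have "regular (outcome H) \<and> history k (outcome H) = H"
    unfolding outcome_def by (metis (mono_tags, lifting) someI_ex)
  then show "regular (outcome H)" "history k (outcome H) = H" by auto
qed

lemma outcome_history:
  assumes r: "regular \<omega>" and jk: "j \<le> k"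
  shows "x j (outcome (history k \<omega>)) = x j \<omega>"
proof (rule regular_eq(1)[OF _ r])
  have H: "history k \<omega> \<in> histories k"
    by (rule history_in_histories[OF regularD(1)[OF r]])
  show "regular (outcome (history k \<omega>))" by (rule outcome[OF H])
  show "history j (outcome (history k \<omega>)) = history j \<omega>"
    using outcome(2)[OF H] take_history[OF jk] by metis
qed

definition gap_at :: "nat \<Rightarrow> nat set list \<Rightarrow> real" where
  "gap_at k H = gap (x k (outcome H))"

text \<open>
  The part of the Lyapunov function that telescopes: the weighted gap of the table and
  the distance to \<open>x\<^sup>*\<close> scaled by the current step size.
\<close>

definition potential_at :: "nat \<Rightarrow> nat set list \<Rightarrow> real" where
  "potential_at k H = real n / (4 * real b) * table_gap (\<lambda>i. \<phi> k i (outcome H))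
     + 1 / \<eta> k (outcome H) * bregman \<psi> xstar (x k (outcome H))"

definition expected_gap :: "nat \<Rightarrow> real" where
  "expected_gap k = expectation (\<lambda>\<omega>. gap_at k (history k \<omega>))"

definition expected_potential :: "nat \<Rightarrow> real" where
  "expected_potential k = expectation (\<lambda>\<omega>. potential_at k (history k \<omega>))"

text \<open>
  All the extensions \<open>H @ [S]\<close> share the state reached after \<open>H\<close>, so the deterministic step applies
  with \<open>p S\<close> the next iterate after \<open>H @ [S]\<close>.  A larger next step size only lowers the potential.
\<close>

lemma conditional_descent:
  assumes H: "H \<in> histories k" and fin: "h (x k (outcome H)) \<noteq> \<infinity>"
  shows "batch_mean n b (\<lambda>S. gap_at (Suc k) (H @ [S]) + potential_at (Suc k) (H @ [S]))
           \<le> 1 / 2 * gap_at k H + potential_at k H"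
proof -
  let ?w = "outcome H" and ?w' = "\<lambda>S. outcome (H @ [S])"
  let ?y = "x k ?w" and ?\<phi> = "\<lambda>i. \<phi> k i ?w" and ?\<tau> = "\<eta> k ?w"
  note r = outcome(1)[OF H]
  have facts: "regular (?w' S)" "B k (?w' S) = S" "x k (?w' S) = ?y" "\<eta> k (?w' S) = ?\<tau>"
      "\<And>i. i \<in> {1..n} \<Longrightarrow> \<phi> k i (?w' S) = ?\<phi> i"
    if S: "S \<in> batches n b" for S
  proof -
    have HS: "H @ [S] \<in> histories (Suc k)" using H S by (auto simp: histories_def)
    show r': "regular (?w' S)" by (rule outcome[OF HS])
    have eq: "history k (?w' S) = H" "B k (?w' S) = S"
      using outcome(2)[OF HS] by (simp_all add: history_Suc)
    then show "B k (?w' S) = S" by simp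
    have "history k (?w' S) = history k ?w" using eq outcome(2)[OF H] by simp
    note regular_eq[OF r' r this]
    then show "x k (?w' S) = ?y" "\<eta> k (?w' S) = ?\<tau>"
      "\<And>i. i \<in> {1..n} \<Longrightarrow> \<phi> k i (?w' S) = ?\<phi> i" by auto
  qed
  have sub: "i \<in> S \<Longrightarrow> i \<in> {1..n}" if "S \<in> batches n b" for S i
    using that by (auto simp: batches_def)
  have saga: "saga_gradient (x k (?w' S)) (\<lambda>i. \<phi> k i (?w' S)) (B k (?w' S)) = saga_gradient ?y ?\<phi> S"
    if S: "S \<in> batches n b" for S
  proof -
    have "(\<Sum>i\<in>S. grad (fs i) ?y - grad (fs i) (\<phi> k i (?w' S))) = (\<Sum>i\<in>S. grad (fs i) ?y - grad (fs i) (?\<phi> i))"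
      "(\<Sum>i=1..n. grad (fs i) (\<phi> k i (?w' S))) = (\<Sum>i=1..n. grad (fs i) (?\<phi> i))"
      using facts(5)[OF S] sub[OF S] by (auto intro!: sum.cong)
    then show ?thesis by (simp only: saga_gradient_def facts[OF S])
  qed
  have table: "table_gap (\<lambda>i. \<phi> (Suc k) i (?w' S)) = table_gap (\<lambda>i. if i \<in> S then ?y else ?\<phi> i)"
    if S: "S \<in> batches n b" for S
    using regularD(2)[OF facts(1)[OF S]] facts[OF S]
    by (intro table_gap_cong) (simp add: ada_bpsg_run_def)
  have le: "gap_at (Suc k) (H @ [S]) + potential_at (Suc k) (H @ [S])
      \<le> gap (x (Suc k) (?w' S)) + (real n / (4 * real b) * table_gap (\<lambda>i. if i \<in> S then ?y else ?\<phi> i)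
            + 1 / ?\<tau> * bregman \<psi> xstar (x (Suc k) (?w' S)))"
    if S: "S \<in> batches n b" for S
  proof -
    have "0 < ?\<tau>" using regularD(5)[OF r, of k] \<eta>min_pos by linarith
    moreover have "?\<tau> \<le> \<eta> (Suc k) (?w' S)"
      using regularD(7)[OF facts(1)[OF S], of k] facts(4)[OF S] by simp
    ultimately have "1 / \<eta> (Suc k) (?w' S) * bregman \<psi> xstar (x (Suc k) (?w' S))
        \<le> 1 / ?\<tau> * bregman \<psi> xstar (x (Suc k) (?w' S))"
      by (intro mult_right_mono bregman_psi_nonneg) (simp add: frac_le)
    then show ?thesis
      by (simp add: gap_at_def potential_at_def table[OF S])
  qed
  have "batch_mean n b (\<lambda>S. gap (x (Suc k) (?w' S))
            + (real n / (4 * real b) * table_gap (\<lambda>i. if i \<in> S then ?y else ?\<phi> i)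
            + 1 / ?\<tau> * bregman \<psi> xstar (x (Suc k) (?w' S))))
      \<le> 1 / 2 * gap ?y + (real n / (4 * real b) * table_gap ?\<phi> + 1 / ?\<tau> * bregman \<psi> xstar ?y)"
  proof (rule lyapunov_step)
    show "0 < ?\<tau>" using regularD(5)[OF r, of k] \<eta>min_pos by linarith
    show "?\<tau> \<le> 1 / (Lup + 32 * \<sigma>b * M / real b)" using regularD(6)[OF r, of k] \<eta>max_le by linarith
    show "is_arg_min (prox_objective h \<psi> (saga_gradient ?y ?\<phi> S) ?\<tau> ?y) (\<lambda>_. True) (x (Suc k) (?w' S))"
      if S: "S \<in> batches n b" for S
      using regular_prox[OF facts(1)[OF S], of k, unfolded saga[OF S]] unfolding facts(3,4)[OF S] .
  qed (use regularD[OF r] regularD[OF facts(1)] fin in auto)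
  moreover have "batch_mean n b (\<lambda>S. gap_at (Suc k) (H @ [S]) + potential_at (Suc k) (H @ [S]))
      \<le> batch_mean n b (\<lambda>S. gap (x (Suc k) (?w' S))
            + (real n / (4 * real b) * table_gap (\<lambda>i. if i \<in> S then ?y else ?\<phi> i)
            + 1 / ?\<tau> * bregman \<psi> xstar (x (Suc k) (?w' S))))"
    by (rule batch_mean_mono) (rule le)
  ultimately show ?thesis
    by (simp add: gap_at_def potential_at_def)
qed

lemma regular_x0: "regular \<omega> \<Longrightarrow> x 0 \<omega> = x0"
  using regularD(2) by (auto simp: ada_bpsg_run_def)

lemma regular_\<phi>0: "regular \<omega> \<Longrightarrow> i \<in> {1..n} \<Longrightarrow> \<phi> 0 i \<omega> = x0"
  using regularD(2) by (auto simp: ada_bpsg_run_def)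

lemma expected_descent:
  assumes x0: "h x0 \<noteq> \<infinity>"
  shows "expected_gap (Suc k) + expected_potential (Suc k)
           \<le> 1 / 2 * expected_gap k + expected_potential k"
proof -
  have "expected_gap (Suc k) + expected_potential (Suc k)
      = expectation (\<lambda>\<omega>. gap_at (Suc k) (history (Suc k) \<omega>) + potential_at (Suc k) (history (Suc k) \<omega>))"
    unfolding expected_gap_def expected_potential_def
    by (intro Bochner_Integration.integral_add[symmetric] history_integrable)
  also have "\<dots> = expectation (\<lambda>\<omega>. batch_mean n b (\<lambda>S. gap_at (Suc k) (history k \<omega> @ [S])
                    + potential_at (Suc k) (history k \<omega> @ [S])))"
    by (rule expectation_history_Suc[of "\<lambda>H. gap_at (Suc k) H + potential_at (Suc k) H"])
  also have "\<dots> \<le> expectation (\<lambda>\<omega>. 1 / 2 * gap_at k (history k \<omega>) + potential_at k (history k \<omega>))"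
  proof (rule integral_mono)
    fix \<omega> assume "\<omega> \<in> space P"
    then have H: "history k \<omega> \<in> histories k" by (rule history_in_histories)
    show "batch_mean n b (\<lambda>S. gap_at (Suc k) (history k \<omega> @ [S]) + potential_at (Suc k) (history k \<omega> @ [S]))
        \<le> 1 / 2 * gap_at k (history k \<omega>) + potential_at k (history k \<omega>)"
    proof (rule conditional_descent[OF H])
      show "h (x k (outcome (history k \<omega>))) \<noteq> \<infinity>"
        using x0 regular_x0[OF outcome(1)[OF H]] regular_h_finite[OF outcome(1)[OF H], of k]
        by (cases k) auto
    qed
  qed (rule history_integrable[of "\<lambda>H. batch_mean n b (\<lambda>S. gap_at (Suc k) (H @ [S]) + potential_at (Suc k) (H @ [S]))"]
        history_integrable[of "\<lambda>H. 1 / 2 * gap_at k H + potential_at k H"])+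
  also have "\<dots> = 1 / 2 * expected_gap k + expected_potential k"
    unfolding expected_gap_def expected_potential_def
    by (simp add: history_integrable)
  finally show ?thesis .
qed

text \<open>
  In \<open>expected_descent\<close> the new gap counts fully and the old one only half, so that half of
  every gap survives the summation.
\<close>

lemma telescoped_descent:
  assumes x0: "h x0 \<noteq> \<infinity>"
  shows "1 / 2 * (\<Sum>k=1..K. expected_gap k) + 1 / 2 * expected_gap K + expected_potential K
           \<le> 1 / 2 * expected_gap 0 + expected_potential 0"
proof (induction K)
  case (Suc K)
  have "(\<Sum>k=1..Suc K. expected_gap k) = (\<Sum>k=1..K. expected_gap k) + expected_gap (Suc K)"
    by simp
  then show ?case using Suc.IH expected_descent[OF x0, of K] by argo
qed simp

lemma regular_gap_nonneg:
  assumes "regular \<omega>" "k \<ge> 1"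
  shows "0 \<le> gap (x k \<omega>)"
  by (rule gap_nonneg[OF regular_h_finite[OF assms]])

lemma regular_table_gap_nonneg: "regular \<omega> \<Longrightarrow> 0 \<le> table_gap (\<lambda>i. \<phi> k i \<omega>)"
  by (intro table_gap_nonneg regularD)

text \<open>
  Initially all table points are \<open>x\<^sub>0\<close>, so the table gap is \<open>D\<^sub>f(x\<^sub>0, x\<^sup>*)\<close>, at most the
  gap of \<open>x\<^sub>0\<close>.
\<close>

lemma sum_expected_gap:
  assumes x0: "h x0 \<noteq> \<infinity>" and K: "K \<ge> 1"
  shows "(\<Sum>k=1..K. expected_gap k)
           \<le> 2 * ((real n / (4 * real b) + 1 / 2) * gap x0 + 1 / \<eta>min * bregman \<psi> xstar x0)"
proof -
  have H: "\<omega> \<in> space P \<Longrightarrow> regular (outcome (history k \<omega>))" for k \<omega>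
    by (rule outcome(1)[OF history_in_histories])
  have "0 \<le> expected_gap K"
    unfolding expected_gap_def
    by (rule Bochner_Integration.integral_nonneg) (unfold gap_at_def, intro regular_gap_nonneg H K)
  moreover have "0 \<le> expected_potential K"
    unfolding expected_potential_def
  proof (rule Bochner_Integration.integral_nonneg)
    fix \<omega> assume "\<omega> \<in> space P"
    note r = H[OF this, of K]
    have "0 < \<eta> K (outcome (history K \<omega>))" using regularD(5)[OF r, of K] \<eta>min_pos by linarith
    then show "0 \<le> potential_at K (history K \<omega>)"
      by (simp add: potential_at_def regular_table_gap_nonneg[OF r] bregman_psi_nonneg)
  qed
  moreover have "expected_gap 0 = gap x0"
  proof -
    have "expected_gap 0 = expectation (\<lambda>\<omega>. gap x0)"
      unfolding expected_gap_def
      by (intro Bochner_Integration.integral_cong refl) (simp add: gap_at_def regular_x0 H)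
    then show ?thesis by (simp add: prob_space)
  qed
  moreover have "expected_potential 0
      \<le> real n / (4 * real b) * gap x0 + 1 / \<eta>min * bregman \<psi> xstar x0"
  proof -
    have "expected_potential 0 \<le> expectation (\<lambda>\<omega>. real n / (4 * real b) * gap x0 + 1 / \<eta>min * bregman \<psi> xstar x0)"
      unfolding expected_potential_def
    proof (rule integral_mono)
      fix \<omega> assume "\<omega> \<in> space P"
      note r = H[OF this, of 0]
      have "table_gap (\<lambda>i. \<phi> 0 i (outcome (history 0 \<omega>))) = table_gap (\<lambda>_. x0)"
        by (intro table_gap_cong regular_\<phi>0 r)
      also have "\<dots> = bregman f x0 xstar"
        by (simp add: table_gap_def bregman_f xstar_D)
      also have "\<dots> \<le> gap x0" by (rule bregman_le_gap[OF x0])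
      finally have "real n / (4 * real b) * table_gap (\<lambda>i. \<phi> 0 i (outcome (history 0 \<omega>)))
          \<le> real n / (4 * real b) * gap x0" by (intro mult_left_mono) auto
      moreover have "1 / \<eta> 0 (outcome (history 0 \<omega>)) * bregman \<psi> xstar x0 \<le> 1 / \<eta>min * bregman \<psi> xstar x0"
        using regularD(5)[OF r, of 0] \<eta>min_pos
        by (intro mult_right_mono bregman_psi_nonneg) (simp add: frac_le)
      ultimately show "potential_at 0 (history 0 \<omega>)
          \<le> real n / (4 * real b) * gap x0 + 1 / \<eta>min * bregman \<psi> xstar x0"
        by (simp add: potential_at_def regular_x0[OF r])
    qed (auto simp: history_integrable)
    then show ?thesis by (simp add: prob_space)
  qed
  ultimately show ?thesis
    using telescoped_descent[OF x0, of K] by (simp add: distrib_right)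
qed

lemma expected_average:
  assumes x0: "h x0 \<noteq> \<infinity>" and K: "K \<ge> 1"
  obtains Y where "integrable P Y"
    and "AE \<omega> in P. ereal (f ((1 / real K) *\<^sub>R (\<Sum>k=1..K. x k \<omega>)))
           + h ((1 / real K) *\<^sub>R (\<Sum>k=1..K. x k \<omega>)) = ereal (Y \<omega>)"
    and "expectation Y - (f xstar + real_of_ereal (h xstar))
           \<le> 2 / real K * ((real n / (4 * real b) + 1 / 2) * gap x0 + 1 / \<eta>min * bregman \<psi> xstar x0)"
proof
  define avg where "avg \<omega> = (1 / real K) *\<^sub>R (\<Sum>k=1..K. x k \<omega>)" for \<omega>
  define Y where "Y \<omega> = f (avg (outcome (history K \<omega>))) + real_of_ereal (h (avg (outcome (history K \<omega>))))" for \<omega>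
  show int: "integrable P Y"
    unfolding Y_def by (rule history_integrable[of "\<lambda>H. f (avg (outcome H)) + real_of_ereal (h (avg (outcome H)))"])
  have avg: "avg (outcome (history K \<omega>)) = avg \<omega>" if "regular \<omega>" for \<omega>
    using outcome_history[OF that] by (simp add: avg_def)
  have average: "h (avg \<omega>) \<noteq> \<infinity>" "gap (avg \<omega>) \<le> (1 / real K) * (\<Sum>k=1..K. gap (x k \<omega>))" if "regular \<omega>" for \<omega>
    using gap_average[OF K _ avg_def, of \<omega>] regularD(3)[OF that] regular_h_finite[OF that] by simp_all
  show "AE \<omega> in P. ereal (f ((1 / real K) *\<^sub>R (\<Sum>k=1..K. x k \<omega>)))
           + h ((1 / real K) *\<^sub>R (\<Sum>k=1..K. x k \<omega>)) = ereal (Y \<omega>)"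
    using AE_regular
  proof eventually_elim
    fix \<omega> assume "regular \<omega>"
    then have "ereal (f (avg \<omega>)) + h (avg \<omega>) = ereal (Y \<omega>)"
      using h_real[OF average(1)] by (simp add: Y_def avg flip: plus_ereal.simps(1))
    then show "ereal (f ((1 / real K) *\<^sub>R (\<Sum>k=1..K. x k \<omega>)))
           + h ((1 / real K) *\<^sub>R (\<Sum>k=1..K. x k \<omega>)) = ereal (Y \<omega>)"
      by (simp only: avg_def)
  qed
  let ?c = "f xstar + real_of_ereal (h xstar)"
  have "expectation Y - ?c = expectation (\<lambda>\<omega>. Y \<omega> - ?c)"
    using int by (simp add: prob_space)
  also have "\<dots> \<le> expectation (\<lambda>\<omega>. (1 / real K) * (\<Sum>k=1..K. gap_at k (history k \<omega>)))"
  proof (rule integral_mono_AE)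
    show "AE \<omega> in P. Y \<omega> - ?c \<le> (1 / real K) * (\<Sum>k=1..K. gap_at k (history k \<omega>))"
      using AE_regular
    proof eventually_elim
      fix \<omega> assume r: "regular \<omega>"
      have "Y \<omega> - ?c = gap (avg \<omega>)" by (simp add: Y_def avg[OF r] gap_def)
      then show "Y \<omega> - ?c \<le> (1 / real K) * (\<Sum>k=1..K. gap_at k (history k \<omega>))"
        using average(2)[OF r] by (simp add: gap_at_def outcome_history[OF r])
    qed
  qed (use int in \<open>auto intro!: integrable_mult_right Bochner_Integration.integrable_sum history_integrable\<close>)
  also have "\<dots> = (1 / real K) * (\<Sum>k=1..K. expected_gap k)"
    unfolding expected_gap_def by (simp add: Bochner_Integration.integral_sum history_integrable)
  also have "\<dots> \<le> (1 / real K) * (2 * ((real n / (4 * real b) + 1 / 2) * gap x0 + 1 / \<eta>min * bregman \<psi> xstar x0))"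
    by (intro mult_left_mono sum_expected_gap x0 K) simp
  finally show "expectation Y - ?c
           \<le> 2 / real K * ((real n / (4 * real b) + 1 / 2) * gap x0 + 1 / \<eta>min * bregman \<psi> xstar x0)"
    by simp
qed

end

section \<open>The bound for the averaged iterate\<close>

theorem theorem3p6:
  fixes n b m K :: nat
    and fs :: "nat \<Rightarrow> 'a::real_normed_vector \<Rightarrow> real"
    and f \<psi> :: "'a \<Rightarrow> real"
    and h F :: "'a \<Rightarrow> ereal"
    and X D :: "'a set"
    and x0 xstar :: 'a
    and \<eta>min \<eta>max \<eta>0 \<alpha> \<theta> \<sigma>b Lup Llow M :: real
    and P :: "'w measure"
    and B :: "nat \<Rightarrow> 'w \<Rightarrow> nat set"
    and x :: "nat \<Rightarrow> 'w \<Rightarrow> 'a"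
    and \<phi> :: "nat \<Rightarrow> nat \<Rightarrow> 'w \<Rightarrow> 'a"
    and \<eta> \<xi> \<delta> :: "nat \<Rightarrow> 'w \<Rightarrow> real"
    and \<mu> :: "nat \<Rightarrow> 'w \<Rightarrow> ('a \<Rightarrow>\<^sub>L real)"
  assumes fin_dim: "\<exists>S::'a set. finite S \<and> span S = UNIV"
    and n: "n \<ge> 1"
    and f_eq: "\<And>u. f u = 1 / real n * (\<Sum>i=1..n. fs i u)"
    and F_eq: "\<And>u. F u = ereal (f u) + h u"
    and X: "X \<noteq> {}" "convex X" "open X"
    and fs_diff: "\<And>i u. i \<in> {1..n} \<Longrightarrow> u \<in> X \<Longrightarrow> fs i differentiable (at u)"
    and f_lsc: "lower_semicontinuous_on X f"
    and f_C1: "continuously_differentiable_on X f"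
    and b: "b \<in> {1..n}"
    and params: "0 < \<eta>min" "\<eta>min \<le> \<eta>max" "\<eta>0 \<in> {\<eta>min..\<eta>max}" "m \<ge> 1" "\<alpha> > 0" "\<theta> > 0"
    and prob: "prob_space P"
    and B_meas: "\<And>k. B k \<in> measurable P (count_space (batches n b))"
    and run: "AE \<omega> in P. ada_bpsg_run n fs h \<psi> b x0 \<eta>min \<eta>max \<eta>0 m \<alpha> \<theta>
                (\<lambda>k. B k \<omega>) (\<lambda>k. x k \<omega>) (\<lambda>k i. \<phi> k i \<omega>)
                (\<lambda>k. \<eta> k \<omega>) (\<lambda>k. \<xi> k \<omega>) (\<lambda>k. \<delta> k \<omega>) (\<lambda>k. \<mu> k \<omega>)"
    and psi_C1: "continuously_differentiable_on UNIV \<psi>"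
    and psi_strong: "\<And>u v. bregman \<psi> u v \<ge> 1 / 2 * (norm (u - v))\<^sup>2"
    and h_pcc: "proper_closed_convex h"
    and prox_unique: "\<And>u G \<tau>. u \<in> D \<Longrightarrow> \<tau> \<in> {\<eta>min..\<eta>max} \<Longrightarrow>
                        \<exists>!v. is_arg_min (prox_objective h \<psi> G \<tau> u) (\<lambda>_. True) v"
    and D: "bounded D" "convex D" "D \<subseteq> X"
    and iter_in_D: "AE \<omega> in P. \<forall>k. x k \<omega> \<in> D \<and> (\<forall>i\<in>{1..n}. \<phi> k i \<omega> \<in> D)"
    and xstar: "is_arg_min F (\<lambda>_. True) xstar" "xstar \<in> D"
    and B_uniform: "\<And>k S. S \<in> batches n b \<Longrightarrow>
          AE \<omega> in P. real_cond_exp P (batch_history P B k) (indicator {\<omega>. B k \<omega> = S}) \<omega>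
                       = 1 / real (n choose b)"
    and sigma: "\<sigma>b \<ge> 1"
    and B_variance: "\<And>k (v :: nat \<Rightarrow> 'a \<Rightarrow>\<^sub>L real) vbar. vbar = (1 / real n) *\<^sub>R (\<Sum>i=1..n. v i) \<Longrightarrow>
          prob_space.expectation P (\<lambda>\<omega>. (norm ((1 / real b) *\<^sub>R (\<Sum>i\<in>B k \<omega>. v i - vbar)))\<^sup>2)
            \<le> \<sigma>b / (real b * real n) * (\<Sum>i=1..n. (norm (v i - vbar))\<^sup>2)"
    and Lup_Llow: "Lup > 0" "Llow \<ge> 0"
    and f_smooth: "\<And>u v. u \<in> D \<Longrightarrow> v \<in> D \<Longrightarrow>
          - Llow * bregman \<psi> u v \<le> f u - f v - blinfun_apply (grad f v) (u - v) \<and>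
          f u - f v - blinfun_apply (grad f v) (u - v) \<le> Lup * bregman \<psi> u v"
    and M: "M \<ge> 0"
    and fs_lipschitz: "\<And>i u v. i \<in> {1..n} \<Longrightarrow> u \<in> D \<Longrightarrow> v \<in> D \<Longrightarrow>
          norm (grad (fs i) u - grad (fs i) v) \<le> M * norm (u - v)"
    and fs_convex: "\<And>i. i \<in> {1..n} \<Longrightarrow> convex_on D (fs i)"
    and fs_cocoercive: "\<And>i u v. i \<in> {1..n} \<Longrightarrow> u \<in> D \<Longrightarrow> v \<in> D \<Longrightarrow>
          (norm (grad (fs i) u - grad (fs i) v))\<^sup>2
            \<le> 2 * M * (fs i u - fs i v - blinfun_apply (grad (fs i) v) (u - v))"
    and steps: "AE \<omega> in P. \<forall>k. \<eta>min \<le> \<eta> k \<omega> \<and> \<eta> k \<omega> \<le> \<eta>max"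
    and steps_mono: "AE \<omega> in P. \<forall>k\<ge>1. \<eta> k \<omega> \<ge> \<eta> (k - 1) \<omega>"
    and eta_max: "\<eta>max \<le> 1 / (Lup + 32 * \<sigma>b * M / real b)"
    and K: "K \<ge> 1"
  shows "ereal_expectation P (\<lambda>\<omega>. F ((1 / real K) *\<^sub>R (\<Sum>k=1..K. x k \<omega>))) - F xstar
           \<le> ereal (2 / real K) *
               (ereal (real n / (4 * real b) + 1 / 2) * (F x0 - F xstar)
                + ereal (1 / \<eta>min * bregman \<psi> xstar x0))"
proof -
  interpret prob_space P by (rule prob)
  interpret uniform_batches P B n b
    by unfold_locales (rule b B_meas B_uniform; assumption)+
  have psi_diff: "\<psi> differentiable (at u)" for u
    using psi_C1 by (simp add: continuously_differentiable_on_def)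
  have xstar_min: "ereal (f xstar) + h xstar \<le> ereal (f u) + h u" for u
    using xstar(1) by (simp add: is_arg_min_linorder F_eq)
  interpret finite_sum_problem n b fs f \<psi> h D xstar Lup M \<sigma>b
  proof unfold_locales
    show "fs i differentiable (at u)" if "i \<in> {1..n}" "u \<in> D" for i u
      using fs_diff that D(3) by blast
    show "f u - f v - blinfun_apply (grad f v) (u - v) \<le> Lup * bregman \<psi> u v"
      if "u \<in> D" "v \<in> D" for u v
      using f_smooth[OF that] by blast
    show "(norm (grad (fs i) u - grad (fs i) v))\<^sup>2 \<le> 2 * M * bregman (fs i) u v"
      if "i \<in> {1..n}" "u \<in> D" "v \<in> D" for i u v
      using fs_cocoercive[OF that] by (simp add: bregman_def)
    show "batch_mean n b (\<lambda>S. (norm ((1 / real b) *\<^sub>R (\<Sum>i\<in>S. v i - vbar)))\<^sup>2)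
            \<le> \<sigma>b / (real b * real n) * (\<Sum>i=1..n. (norm (v i - vbar))\<^sup>2)"
      if "vbar = (1 / real n) *\<^sub>R (\<Sum>i=1..n. v i)" for v :: "nat \<Rightarrow> 'a \<Rightarrow>\<^sub>L real" and vbar
      using B_variance[OF that, of 0]
        expectation_batch[of "\<lambda>S. (norm ((1 / real b) *\<^sub>R (\<Sum>i\<in>S. v i - vbar)))\<^sup>2" 0]
      by simp
  qed (fact b f_eq psi_diff psi_strong h_pcc D(2) xstar(2) xstar_min Lup_Llow(1) M sigma fs_convex)+
  interpret ada_bpsg n b fs f \<psi> h D xstar Lup M \<sigma>b P B x0 \<eta>min \<eta>max \<eta>0 \<alpha> \<theta> m x \<phi> \<eta> \<xi> \<delta> \<mu>
    by unfold_locales (fact params(1) eta_max prox_unique run iter_in_D steps steps_mono)+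
  have F_real: "F u = ereal (f u + real_of_ereal (h u))" if "h u \<noteq> \<infinity>" for u
    using h_real[OF that] by (simp add: F_eq flip: plus_ereal.simps(1))
  note Fxstar = F_real[OF h_xstar]
  show ?thesis
  proof (cases "h x0 = \<infinity>")
    case True
    \<comment> \<open>Here \<open>F x0 = \<infinity>\<close>, and the bound is infinite.\<close>
    have "real n / (4 * real b) + 1 / 2 > 0" by (simp add: add_nonneg_pos)
    then show ?thesis
      using K by (simp add: Fxstar F_eq[of x0] True)
  next
    case False
    have Fx0: "F x0 - F xstar = ereal (gap x0)"
      by (simp add: Fxstar F_real[OF False] gap_def)
    obtain Y where Y: "integrable P Y"
      "AE \<omega> in P. F ((1 / real K) *\<^sub>R (\<Sum>k=1..K. x k \<omega>)) = ereal (Y \<omega>)"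
      "expectation Y - (f xstar + real_of_ereal (h xstar))
         \<le> 2 / real K * ((real n / (4 * real b) + 1 / 2) * gap x0 + 1 / \<eta>min * bregman \<psi> xstar x0)"
      using expected_average[OF False K] unfolding F_eq[symmetric] by blast
    have "ereal_expectation P (\<lambda>\<omega>. F ((1 / real K) *\<^sub>R (\<Sum>k=1..K. x k \<omega>))) = ereal (expectation Y)"
      using ereal_expectation_cong_AE[OF Y(2)] ereal_expectation_integrable[OF Y(1)] by simp
    then show ?thesis
      unfolding Fx0 using Y(3) by (simp add: Fxstar)
  qed
qed

end
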